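(* Let $f,g\colon (\mathbb{C}^n,0)\to (\mathbb{C},0)$ be two reduced holomorphic function-germs. Let $\varphi\colon (\mathbb{C}^n,0)\to (\mathbb{C}^n,0)$ be a (germ of) blow-spherical homeomorphism such that $f=g\circ \varphi$. Then the Milnor fibres $f_*^{-1}(1)$ and $g_*^{-1}(1)$ of the initial forms of $f$ and $g$ are homotopy equivalent.
   Context: A holomorphic function-germ $f\colon(\mathbb{C}^n,0)\to(\mathbb{C},0)$, not identically zero, is written $f=f_m+f_{m+1}+\cdots$, where each $f_j$ is identically zero or a homogeneous polynomial of degree $j$, and $f_m\neq 0$. Then $m=\mathrm{ord}_0 f$, and $f_*:=f_m$ is called the initial form of $f$. The Milnor fibre of $f_*$ is $f_*^{-1}(1)=\{x\in\mathbb{C}^n: f_*(x)=1\}$. A germ is reduced if it is not identically zero and has no repeated irreducible factor. Blow-spherical homeomorphism: the spherical blowing-up of $\mathbb{R}^p$ at $0$ is $\rho_p\colon\mathbb{S}^{p-1}\times [0,+\infty )\to \mathbb{R}^{p}$, $\rho_{p}(x,t)=tx$; it restricts to a homeomorphism $\mathbb{S}^{p-1}\times(0,+\infty)\to\mathbb{R}^p\setminus\{0\}$ with inverse $x\mapsto(\frac{x}{\|x\|},\|x\|)$. For $X\subset\mathbb{R}^p$, the strict transform is $X'=\overline{\rho_{p}^{-1}(X\setminus \{0\})}$ and its boundary is $\partial X'=X'\cap (\mathbb{S}^{p-1}\times \{0\})$. For $X\subset\mathbb{R}^p$, $Y\subset\mathbb{R}^q$, a homeomorphism $\varphi\colon(X,0)\to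 (Y,0)$ is a blow-spherical homeomorphism (at $0$) if the homeomorphism $\rho^{-1}_{q}\circ \varphi\circ \rho_{p} \colon X'\setminus \partial X'\to Y'\setminus \partial Y'$ extends to a homeomorphism $\varphi'\colon X'\to Y'$. For germs $\varphi\colon(\mathbb{C}^n,0)\to(\mathbb{C}^n,0)$, with $\mathbb{C}^n=\mathbb{R}^{2n}$, this means that $\rho_{2n}^{-1}\circ\varphi\circ\rho_{2n}$ extends to a homeomorphism between neighbourhoods of $\mathbb{S}^{2n-1}\times\{0\}$ in $\mathbb{S}^{2n-1}\times[0,+\infty)$ mapping $\mathbb{S}^{2n-1}\times\{0\}$ onto itself. *)

theory Defs
  imports "HOL-Analysis.Analysis"
begin

text \<open>Germs at the origin of \<open>\<complex>\<^sup>n\<close> are represented by total functions on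
  \<^typ>\<open>complex^'n\<close>; only the values near 0 matter, and equality of germs is
  equality on some neighbourhood of 0.\<close>

section \<open>Holomorphic function-germs\<close>

definition germ_eq :: "(complex^'n \<Rightarrow> 'b) \<Rightarrow> (complex^'n \<Rightarrow> 'b) \<Rightarrow> bool" where
  "germ_eq f g \<longleftrightarrow> (\<forall>\<^sub>F x in nhds 0. f x = g x)"

text \<open>Complex differentiability in several variables: the real Frechet derivative exists and
  is complex linear at every point of a neighbourhood of 0.\<close>

definition holomorphic_germ :: "(complex^'n \<Rightarrow> complex) \<Rightarrow> bool" where
  "holomorphic_germ f \<longleftrightarrow>
     (\<exists>U. open U \<and> 0 \<in> U \<and>
        (\<forall>x\<in>U. \<exists>L. (f has_derivative L) (at x) \<and> (\<forall>c v. L (c *s v) = c * L v)))"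

text \<open>Divisibility and irreducibility in the ring of holomorphic germs at 0 (the germs here
  need not vanish at 0); these unfold the library notions \<open>dvd\<close> and \<open>irreducible\<close>.\<close>

definition germ_dvd :: "(complex^'n \<Rightarrow> complex) \<Rightarrow> (complex^'n \<Rightarrow> complex) \<Rightarrow> bool" where
  "germ_dvd p f \<longleftrightarrow> (\<exists>q. holomorphic_germ q \<and> germ_eq f (\<lambda>x. p x * q x))"

definition germ_irreducible :: "(complex^'n \<Rightarrow> complex) \<Rightarrow> bool" where
  "germ_irreducible p \<longleftrightarrow>
     holomorphic_germ p \<and> \<not> germ_eq p (\<lambda>_. 0) \<and> \<not> germ_dvd p (\<lambda>_. 1) \<and>
     (\<forall>a b. holomorphic_germ a \<and> holomorphic_germ b \<and> germ_eq p (\<lambda>x. a x * b x) \<longrightarrow>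
        germ_dvd a (\<lambda>_. 1) \<or> germ_dvd b (\<lambda>_. 1))"

definition reduced_germ :: "(complex^'n \<Rightarrow> complex) \<Rightarrow> bool" where
  "reduced_germ f \<longleftrightarrow>
     \<not> germ_eq f (\<lambda>_. 0) \<and>
     \<not> (\<exists>p. germ_irreducible p \<and> germ_dvd (\<lambda>x. p x ^ 2) f)"

section \<open>Initial forms\<close>

text \<open>The zero function is included; multi-indices are functions from \<^typ>\<open>'n\<close> to
  \<^typ>\<open>nat\<close>, and those of total degree \<open>d\<close> form a finite set.\<close>

definition homogeneous_polynomial :: "nat \<Rightarrow> (complex^'n \<Rightarrow> complex) \<Rightarrow> bool" where
  "homogeneous_polynomial d h \<longleftrightarrow>
     (\<exists>c :: ('n \<Rightarrow> nat) \<Rightarrow> complex. \<forall>x.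
        h x = (\<Sum>\<alpha> | (\<Sum>i\<in>UNIV. \<alpha> i) = d. c \<alpha> * (\<Prod>i\<in>UNIV. (x $ i) ^ \<alpha> i)))"

definition homogeneous_expansion ::
    "(complex^'n \<Rightarrow> complex) \<Rightarrow> (nat \<Rightarrow> complex^'n \<Rightarrow> complex) \<Rightarrow> bool" where
  "homogeneous_expansion f F \<longleftrightarrow>
     (\<forall>j. homogeneous_polynomial j (F j)) \<and> (\<forall>\<^sub>F x in nhds 0. (\<lambda>j. F j x) sums f x)"

text \<open>The three definitions below are meaningful for holomorphic germs, which have exactly one
  homogeneous expansion (and, for the last two, only if the germ is not identically 0).\<close>

definition homogeneous_component ::
    "(complex^'n \<Rightarrow> complex) \<Rightarrow> nat \<Rightarrow> complex^'n \<Rightarrow> complex" where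
  "homogeneous_component f = (THE F. homogeneous_expansion f F)"

definition germ_order :: "(complex^'n \<Rightarrow> complex) \<Rightarrow> nat" where
  "germ_order f = (LEAST m. homogeneous_component f m \<noteq> (\<lambda>_. 0))"

definition initial_form :: "(complex^'n \<Rightarrow> complex) \<Rightarrow> complex^'n \<Rightarrow> complex" where
  "initial_form f = homogeneous_component f (germ_order f)"

definition milnor_fibre :: "(complex^'n \<Rightarrow> complex) \<Rightarrow> (complex^'n) set" where
  "milnor_fibre h = {x. h x = 1}"

section \<open>Blow-spherical homeomorphisms\<close>

text \<open>The norm of \<^typ>\<open>complex^'n\<close> is the Euclidean norm of the underlying real vector space
  of dimension \<open>2n\<close>, so \<open>sphere 0 1\<close> below is the unit sphere of dimension \<open>2n - 1\<close>.\<close>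

definition spherical_blowup :: "'a::real_normed_vector \<times> real \<Rightarrow> 'a" where
  "spherical_blowup = (\<lambda>(x, t). t *\<^sub>R x)"

text \<open>Inverse of \<^const>\<open>spherical_blowup\<close> away from the exceptional sphere; only meaningful
  at nonzero points.\<close>

definition spherical_blowup_inv :: "'a::real_normed_vector \<Rightarrow> 'a \<times> real" where
  "spherical_blowup_inv x = (x /\<^sub>R norm x, norm x)"

definition exceptional_nhd :: "('a::real_normed_vector \<times> real) set \<Rightarrow> bool" where
  "exceptional_nhd A \<longleftrightarrow>
     openin (top_of_set (sphere 0 1 \<times> {0..})) A \<and> sphere 0 1 \<times> {0} \<subseteq> A"

text \<open>\<open>\<phi>\<close> restricts to a homeomorphism \<open>U \<rightarrow> V\<close> of neighbourhoods of 0 fixing 0, and its lift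
  extends over the exceptional sphere to a homeomorphism \<open>A \<rightarrow> B\<close>. The set \<open>A\<close> has to lie
  over \<open>U\<close>, since \<open>\<phi>\<close> carries no information elsewhere.\<close>

definition blow_spherical_homeomorphism_germ ::
    "('a::real_normed_vector \<Rightarrow> 'a) \<Rightarrow> bool" where
  "blow_spherical_homeomorphism_germ \<phi> \<longleftrightarrow>
     (\<exists>U V \<psi>. open U \<and> 0 \<in> U \<and> open V \<and> 0 \<in> V \<and> homeomorphism U V \<phi> \<psi> \<and> \<phi> 0 = 0 \<and>
       (\<exists>A B \<Phi> \<Psi>. exceptional_nhd A \<and> exceptional_nhd B \<and> homeomorphism A B \<Phi> \<Psi> \<and>
          \<Phi> ` (sphere 0 1 \<times> {0}) = sphere 0 1 \<times> {0} \<and>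
          (\<forall>(x, t)\<in>A. t > 0 \<longrightarrow> spherical_blowup (x, t) \<in> U \<and>
             \<Phi> (x, t) = spherical_blowup_inv (\<phi> (spherical_blowup (x, t))))))"

end

theory Submission
  imports Defs "HOL-Complex_Analysis.Great_Picard" "HOL-Computational_Algebra.Polynomial"
begin

text \<open>Let \<open>h\<close>, \<open>k\<close> be the initial forms of \<open>f\<close>, \<open>g\<close>, of degrees \<open>m\<close>, \<open>n\<close>, and let \<open>\<nu>\<close> be the
  homeomorphism of the unit sphere given by the extension of the lift of \<open>\<phi>\<close>. For \<open>t > 0\<close> small and
  \<open>\<phi> (t x) = s y\<close> with \<open>norm y = 1\<close>, the equation \<open>f (t x) = g (s y)\<close> reads
  \<open>t\<^sup>m (h x + O(t)) = s\<^sup>n (k y + O(s))\<close>, and \<open>y\<close> tends to \<open>\<nu> x\<close> as \<open>t\<close> tends to 0.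
  If \<open>k (\<nu> x) \<noteq> 0\<close>, then \<open>f\<close> has no zeros in directions close to \<open>x\<close>, so \<open>h x \<noteq> 0\<close> by Hurwitz'
  theorem; the converse holds by symmetry. Since \<open>t\<^sup>m\<close> and \<open>s\<^sup>n\<close> are positive, \<open>h x\<close> and \<open>k (\<nu> x)\<close>
  then have the same argument, even if \<open>m \<noteq> n\<close>. Hence \<open>\<nu>\<close> maps the part of the sphere where
  \<open>h > 0\<close> onto the part where \<open>k > 0\<close>, and radial projection identifies these parts with the
  Milnor fibres.\<close>

section \<open>Polynomial functions on \<open>\<complex>\<^sup>n\<close>\<close>

lemma norm_vector_scalar_mult: "norm (c *s x) = cmod c * norm x" for x :: "complex^'n"
  by (simp add: norm_vec_def L2_set_right_distrib norm_mult)

lemma vector_scaleR_eq_scalar_mult: "t *\<^sub>R x = complex_of_real t *s x" for x :: "complex^'n"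
  unfolding vec_eq_iff vector_scaleR_component vector_smult_component
  by (simp add: scaleR_conv_of_real)

lemma bounded_linear_vector_scalar_mult: "bounded_linear (\<lambda>h. h *s v)" for v :: "complex^'n"
  by (rule bounded_linear_intro [where K = "norm v"])
     (auto simp: norm_vector_scalar_mult vec_eq_iff algebra_simps)

lemma finite_multi_indices: "finite {\<alpha> :: 'n::finite \<Rightarrow> nat. (\<Sum>i\<in>UNIV. \<alpha> i) = d}"
proof (rule finite_subset)
  show "{\<alpha> :: 'n \<Rightarrow> nat. (\<Sum>i\<in>UNIV. \<alpha> i) = d} \<subseteq> UNIV \<rightarrow>\<^sub>E {..d}"
    by (auto simp: member_le_sum)
qed (simp add: finite_PiE)

lemma homogeneous_polynomial_scalar_mult:
  assumes "homogeneous_polynomial d h"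
  shows "h (c *s x) = c ^ d * h x"
proof -
  obtain a where a: "h y = (\<Sum>\<alpha> | (\<Sum>i\<in>UNIV. \<alpha> i) = d. a \<alpha> * (\<Prod>i\<in>UNIV. (y $ i) ^ \<alpha> i))" for y
    using assms unfolding homogeneous_polynomial_def by blast
  have "(\<Prod>i\<in>UNIV. ((c *s x) $ i) ^ \<alpha> i) = c ^ d * (\<Prod>i\<in>UNIV. (x $ i) ^ \<alpha> i)"
    if "(\<Sum>i\<in>UNIV. \<alpha> i) = d" for \<alpha>
    using that by (auto simp: power_mult_distrib prod.distrib power_sum simp del: mult_cancel_left mult_cancel_right)
  then show ?thesis
    by (simp add: a sum_distrib_left mult.left_commute)
qed

lemma continuous_on_homogeneous_polynomial:
  assumes "homogeneous_polynomial d h"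
  shows "continuous_on S h"
proof -
  obtain a where a: "h = (\<lambda>y. \<Sum>\<alpha> | (\<Sum>i\<in>UNIV. \<alpha> i) = d. a \<alpha> * (\<Prod>i\<in>UNIV. (y $ i) ^ \<alpha> i))"
    using assms unfolding homogeneous_polynomial_def by blast
  show ?thesis
    unfolding a by (intro continuous_intros)
qed

lemma holomorphic_on_homogeneous_polynomial_line:
  assumes "homogeneous_polynomial d h"
  shows "(\<lambda>z. h (a + z *s v)) holomorphic_on S"
proof -
  obtain c where c: "h = (\<lambda>y. \<Sum>\<alpha> | (\<Sum>i\<in>UNIV. \<alpha> i) = d. c \<alpha> * (\<Prod>i\<in>UNIV. (y $ i) ^ \<alpha> i))"
    using assms unfolding homogeneous_polynomial_def by blast
  show ?thesis
    unfolding c by (simp, intro holomorphic_intros)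
qed

lemma homogeneous_polynomial_0: "homogeneous_polynomial d (\<lambda>_. 0)"
  unfolding homogeneous_polynomial_def by (rule exI [of _ "\<lambda>_. 0"]) simp

lemma homogeneous_polynomial_const: "homogeneous_polynomial 0 (\<lambda>_ :: complex^'n. a)"
proof -
  have "{\<alpha> :: 'n \<Rightarrow> nat. (\<Sum>i\<in>UNIV. \<alpha> i) = 0} = {\<lambda>_. 0}"
    by (auto simp: fun_eq_iff)
  then show ?thesis
    unfolding homogeneous_polynomial_def
    by (intro exI [of _ "\<lambda>_. a"]) (simp del: sum_eq_0_iff)
qed

lemma homogeneous_polynomial_add:
  assumes "homogeneous_polynomial d h" "homogeneous_polynomial d k"
  shows "homogeneous_polynomial d (\<lambda>x. h x + k x)"
proof -
  obtain a where a: "h x = (\<Sum>\<alpha> | (\<Sum>i\<in>UNIV. \<alpha> i) = d. a \<alpha> * (\<Prod>i\<in>UNIV. (x $ i) ^ \<alpha> i))" for x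
    using assms(1) unfolding homogeneous_polynomial_def by blast
  obtain b where b: "k x = (\<Sum>\<alpha> | (\<Sum>i\<in>UNIV. \<alpha> i) = d. b \<alpha> * (\<Prod>i\<in>UNIV. (x $ i) ^ \<alpha> i))" for x
    using assms(2) unfolding homogeneous_polynomial_def by blast
  show ?thesis
    unfolding homogeneous_polynomial_def
    by (intro exI [of _ "\<lambda>\<alpha>. a \<alpha> + b \<alpha>"]) (simp add: a b distrib_right sum.distrib)
qed

text \<open>Multiplication by a coordinate raises the \<open>i\<close>-th exponent by one, so the
  coefficients are transported along \<open>up\<close>. Multi-indices of degree \<open>Suc d\<close>
  with \<open>i\<close>-th exponent 0 are missed by \<open>up\<close> and get coefficient 0.\<close>

lemma homogeneous_polynomial_mult_coordinate:
  fixes h :: "complex^'n \<Rightarrow> complex"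
  assumes "homogeneous_polynomial d h"
  shows "homogeneous_polynomial (Suc d) (\<lambda>x. h x * x $ i)"
proof -
  obtain a where a: "h x = (\<Sum>\<alpha> | (\<Sum>i\<in>UNIV. \<alpha> i) = d. a \<alpha> * (\<Prod>i\<in>UNIV. (x $ i) ^ \<alpha> i))" for x
    using assms unfolding homogeneous_polynomial_def by blast
  define I where "I d = {\<alpha> :: 'n \<Rightarrow> nat. (\<Sum>i\<in>UNIV. \<alpha> i) = d}" for d
  have fin: "finite (I d)" for d
    unfolding I_def by (rule finite_multi_indices)
  define up where "up \<alpha> = \<alpha>(i := Suc (\<alpha> i))" for \<alpha> :: "'n \<Rightarrow> nat"
  define down where "down \<alpha> = \<alpha>(i := \<alpha> i - 1)" for \<alpha> :: "'n \<Rightarrow> nat"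
  have split: "(\<Sum>k\<in>UNIV. \<alpha> k) = \<alpha> i + (\<Sum>k\<in>UNIV - {i}. \<alpha> k)" for \<alpha> :: "'n \<Rightarrow> nat"
    by (rule sum.remove) auto
  have up_sum: "(\<Sum>k\<in>UNIV. up \<alpha> k) = Suc (\<Sum>k\<in>UNIV. \<alpha> k)" for \<alpha>
    unfolding split [of "up \<alpha>"] split [of \<alpha>] by (simp add: up_def)
  have up_prod: "(\<Prod>k\<in>UNIV. (x $ k) ^ up \<alpha> k) = (\<Prod>k\<in>UNIV. (x $ k) ^ \<alpha> k) * x $ i"
    for \<alpha> and x :: "complex^'n"
  proof -
    have "(\<Prod>k\<in>UNIV. (x $ k) ^ \<beta> k) = (x $ i) ^ \<beta> i * (\<Prod>k\<in>UNIV - {i}. (x $ k) ^ \<beta> k)" for \<beta>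
      by (rule prod.remove) auto
    from this [of "up \<alpha>"] this [of \<alpha>] show ?thesis
      by (simp add: up_def)
  qed
  have down_up: "down (up \<alpha>) = \<alpha>" for \<alpha>
    by (simp add: up_def down_def)
  have up_down: "up (down \<alpha>) = \<alpha>" if "\<alpha> i > 0" for \<alpha>
    using that by (simp add: up_def down_def)
  have image: "up ` I d = {\<alpha> \<in> I (Suc d). \<alpha> i > 0}"
  proof (intro equalityI subsetI)
    fix \<alpha> assume "\<alpha> \<in> {\<alpha> \<in> I (Suc d). \<alpha> i > 0}"
    then have "up (down \<alpha>) = \<alpha>" "(\<Sum>k\<in>UNIV. \<alpha> k) = Suc d"
      by (auto simp: up_down I_def)
    with up_sum [of "down \<alpha>"] show "\<alpha> \<in> up ` I d"
      by (intro image_eqI [of _ _ "down \<alpha>"]) (auto simp: I_def)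
  qed (auto simp: I_def up_sum, auto simp: up_def)
  define b where "b \<alpha> = (if \<alpha> i = 0 then 0 else a (down \<alpha>))" for \<alpha>
  have "h x * x $ i = (\<Sum>\<alpha>\<in>I (Suc d). b \<alpha> * (\<Prod>k\<in>UNIV. (x $ k) ^ \<alpha> k))" for x
  proof -
    have "(\<Sum>\<alpha>\<in>I (Suc d). b \<alpha> * (\<Prod>k\<in>UNIV. (x $ k) ^ \<alpha> k)) =
          (\<Sum>\<alpha>\<in>up ` I d. b \<alpha> * (\<Prod>k\<in>UNIV. (x $ k) ^ \<alpha> k))"
      unfolding image using fin by (intro sum.mono_neutral_right) (auto simp: b_def)
    also have "\<dots> = (\<Sum>\<alpha>\<in>I d. b (up \<alpha>) * (\<Prod>k\<in>UNIV. (x $ k) ^ up \<alpha> k))"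
      by (subst sum.reindex) (auto intro: inj_on_inverseI [of _ down] simp: down_up)
    also have "\<dots> = (\<Sum>\<alpha>\<in>I d. a \<alpha> * (\<Prod>k\<in>UNIV. (x $ k) ^ \<alpha> k) * x $ i)"
      by (intro sum.cong refl) (simp add: up_prod b_def down_up, simp add: up_def)
    finally show ?thesis
      by (simp add: a I_def sum_distrib_right)
  qed
  then show ?thesis
    unfolding homogeneous_polynomial_def I_def by (intro exI [of _ b] allI)
qed

section \<open>Polynomial functions of unrestricted degree and their homogeneous parts\<close>

inductive mpoly_fun :: "(complex^'n \<Rightarrow> complex) \<Rightarrow> bool" where
  const: "mpoly_fun (\<lambda>_. a)"
| add: "mpoly_fun h \<Longrightarrow> mpoly_fun k \<Longrightarrow> mpoly_fun (\<lambda>x. h x + k x)"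
| mult_coordinate: "mpoly_fun h \<Longrightarrow> mpoly_fun (\<lambda>x. h x * x $ i)"

lemma mpoly_fun_mult_const:
  assumes "mpoly_fun h"
  shows "mpoly_fun (\<lambda>x. h x * a)"
  using assms
proof induction
  case (mult_coordinate h i)
  then show ?case
    using mpoly_fun.mult_coordinate [of "\<lambda>x. h x * a" i] by (simp add: mult_ac)
next
  case (const b)
  show ?case
    by (rule mpoly_fun.const)
next
  case (add h k)
  then show ?case
    unfolding distrib_right by (intro mpoly_fun.add)
qed

lemma mpoly_fun_sum:
  assumes "\<And>k. k \<in> K \<Longrightarrow> mpoly_fun (h k)"
  shows "mpoly_fun (\<lambda>x. \<Sum>k\<in>K. h k x)"
  using assms
  by (induction K rule: infinite_finite_induct) (simp_all add: mpoly_fun.const mpoly_fun.add)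

text \<open>Horner's scheme: the coordinate that multiplies the rest of the polynomial is absorbed
  into \<open>h\<close>, which is why \<open>h\<close> is generalised in the induction.\<close>

lemma mpoly_fun_mult_poly:
  assumes "mpoly_fun h"
  shows "mpoly_fun (\<lambda>x. h x * poly p (x $ i))"
  using assms
proof (induction p arbitrary: h)
  case (pCons a p)
  have "mpoly_fun (\<lambda>x. h x * a + h x * x $ i * poly p (x $ i))"
    by (intro mpoly_fun.add mpoly_fun_mult_const pCons mpoly_fun.mult_coordinate)
  then show ?case
    by (simp add: algebra_simps)
qed (simp add: mpoly_fun.const)

text \<open>Induction over the three generators. The family \<open>H\<close> is total and vanishes
  from \<open>N\<close> on, so that two decompositions can be padded to the same length.\<close>

lemma mpoly_fun_homogeneous_sum:
  assumes "mpoly_fun h"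
  shows "\<exists>N H. (\<forall>d. homogeneous_polynomial d (H d)) \<and> (\<forall>d\<ge>N. H d = (\<lambda>_. 0)) \<and>
           (\<forall>x. h x = (\<Sum>d<N. H d x))"
  using assms
proof induction
  case (const a)
  show ?case
    by (rule exI [of _ 1], rule exI [of _ "\<lambda>d. if d = 0 then (\<lambda>_. a) else (\<lambda>_. 0)"])
       (auto simp: homogeneous_polynomial_const homogeneous_polynomial_0)
next
  case (add h k)
  then obtain N H N' H' where
    H: "\<And>d. homogeneous_polynomial d (H d)" "\<And>d. d \<ge> N \<Longrightarrow> H d = (\<lambda>_. 0)" "\<And>x. h x = (\<Sum>d<N. H d x)"
    and H': "\<And>d. homogeneous_polynomial d (H' d)" "\<And>d. d \<ge> N' \<Longrightarrow> H' d = (\<lambda>_. 0)" "\<And>x. k x = (\<Sum>d<N'. H' d x)"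
    by blast
  have "(\<Sum>d<N. H d x) = (\<Sum>d<max N N'. H d x)" "(\<Sum>d<N'. H' d x) = (\<Sum>d<max N N'. H' d x)" for x
    using H(2) [THEN fun_cong, of _ x] H'(2) [THEN fun_cong, of _ x]
    by (auto intro!: sum.mono_neutral_left simp: not_less [symmetric])
  then show ?case
    using H H'
    by (intro exI [of _ "max N N'"] exI [of _ "\<lambda>d x. H d x + H' d x"])
       (auto simp: homogeneous_polynomial_add sum.distrib)
next
  case (mult_coordinate h i)
  then obtain N H where
    H: "\<And>d. homogeneous_polynomial d (H d)" "\<And>d. d \<ge> N \<Longrightarrow> H d = (\<lambda>_. 0)" "\<And>x. h x = (\<Sum>d<N. H d x)"
    by blast
  \<comment> \<open>All degrees go up by one, so the new component of degree 0 is 0.\<close>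
  define K where "K d = (case d of 0 \<Rightarrow> (\<lambda>_. 0) | Suc d \<Rightarrow> (\<lambda>x. H d x * x $ i))" for d
  show ?case
  proof (rule exI [of _ "Suc N"], rule exI [of _ K], intro conjI allI impI)
    show "homogeneous_polynomial d (K d)" for d
      by (cases d) (auto simp: K_def homogeneous_polynomial_0 intro: homogeneous_polynomial_mult_coordinate H)
    show "K d = (\<lambda>_. 0)" if "d \<ge> Suc N" for d
      using that by (cases d) (auto simp: K_def H)
    show "h x * x $ i = (\<Sum>d<Suc N. K d x)" for x
      by (simp only: sum.lessThan_Suc_shift) (simp add: K_def H(3) sum_distrib_right)
  qed
qed

text \<open>For fixed \<open>x\<close>, expanding \<open>h (c *s x)\<close> by degrees and writing
  it as \<open>c ^ j * h x\<close> gives two polynomials in \<open>c\<close>; comparing coefficients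
  leaves only the component of degree \<open>j\<close>.\<close>

lemma homogeneous_polynomial_if_mpoly_fun:
  assumes "mpoly_fun h" and hom: "\<And>c x. h (c *s x) = c ^ j * h x"
  shows "homogeneous_polynomial j h"
proof -
  obtain N H where H: "\<And>d. homogeneous_polynomial d (H d)" "\<And>d. d \<ge> N \<Longrightarrow> H d = (\<lambda>_. 0)"
      "\<And>x. h x = (\<Sum>d<N. H d x)"
    using mpoly_fun_homogeneous_sum [OF assms(1)] by blast
  have "h x = H j x" for x
  proof -
    \<comment> \<open>The range up to \<open>N+j\<close> contains all indices below \<open>N\<close>
      and also \<open>j\<close> itself.\<close>
    have "(\<Sum>d\<le>N+j. H d x * c ^ d) = (\<Sum>d\<le>N+j. (if d = j then h x else 0) * c ^ d)" for c
    proof -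
      have "(\<Sum>d\<le>N+j. H d x * c ^ d) = (\<Sum>d<N. H d x * c ^ d)"
        by (rule sum.mono_neutral_right) (auto simp: H(2))
      also have "\<dots> = h (c *s x)"
        by (simp add: H(3) homogeneous_polynomial_scalar_mult [OF H(1)] mult.commute)
      also have "\<dots> = (\<Sum>d\<le>N+j. (if d = j then h x else 0) * c ^ d)"
        by (simp add: hom if_distrib if_distribR mult.commute cong: if_cong)
      finally show ?thesis .
    qed
    then have "\<forall>d\<le>N+j. H d x = (if d = j then h x else 0)"
      by (subst polyfun_eq_coeffs [symmetric]) blast
    then show ?thesis
      by simp
  qed
  then have "h = H j" by blast
  then show ?thesis by (simp add: H)
qed

section \<open>Interpolation, and polynomiality deduced from complex lines\<close>

lemma lagrange_interpolation:
  obtains L :: "nat \<Rightarrow> complex poly"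
  where "\<And>p w. degree p \<le> j \<Longrightarrow> poly p w = (\<Sum>k\<le>j. poly p (of_nat k) * poly (L k) w)"
proof
  \<comment> \<open>The Lagrange basis for the nodes \<open>0, ..., j\<close>: for
    \<open>k \<le> j\<close>, \<open>L k\<close> is 1 at \<open>k\<close> and 0 at the other
    nodes.\<close>
  define L :: "nat \<Rightarrow> complex poly" where
    "L k = (\<Prod>i\<in>{..j} - {k}. smult (1 / (of_nat k - of_nat i)) [:- of_nat i, 1:])" for k
  have deg: "degree (L k) \<le> j" if "k \<le> j" for k
  proof -
    have "degree (L k) \<le> (\<Sum>i\<in>{..j} - {k}. 1)"
      unfolding L_def by (rule order_trans [OF degree_prod_sum_le]) (auto intro!: sum_mono)
    then show ?thesis
      using that by simp
  qed
  have val: "poly (L k) (of_nat i) = (if i = k then 1 else 0)" if "k \<le> j" "i \<le> j" for k i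
    using that by (auto simp: L_def poly_prod diff_divide_distrib [symmetric] intro!: prod.neutral)
  show "poly p w = (\<Sum>k\<le>j. poly p (of_nat k) * poly (L k) w)" if "degree p \<le> j" for p w
  proof -
    define q where "q = (\<Sum>k\<le>j. smult (poly p (of_nat k)) (L k))"
    \<comment> \<open>Two polynomials of degree at most \<open>j\<close> that agree at
      \<open>j + 1\<close> points coincide.\<close>
    have "p = q"
    proof (rule poly_eqI_degree [of "of_nat ` {..j}"])
      show "poly p x = poly q x" if "x \<in> of_nat ` {..j}" for x
        using that by (auto simp: q_def poly_sum val if_distrib cong: if_cong)
      have card: "card (of_nat ` {..j} :: complex set) = Suc j"
        by (simp add: card_image inj_on_def)
      show "degree p < card (of_nat ` {..j} :: complex set)"
        using that by (simp add: card)
      have "degree q \<le> j"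
        unfolding q_def by (intro degree_sum_le) (auto intro: deg)
      then show "degree q < card (of_nat ` {..j} :: complex set)"
        by (simp add: card)
    qed
    then have "poly p w = poly q w"
      by simp
    then show ?thesis
      by (simp add: q_def poly_sum)
  qed
qed

text \<open>The bound \<open>j\<close> is uniform, so each coordinate in turn can be made polynomial by
  interpolation at the nodes \<open>0, \<dots>, j\<close>.\<close>

lemma mpoly_fun_if_polynomial_on_lines:
  fixes h :: "complex^'n \<Rightarrow> complex"
  assumes "\<And>a v. \<exists>p. degree p \<le> j \<and> (\<forall>w. h (a + w *s v) = poly p w)"
  shows "mpoly_fun h"
proof -
  obtain L :: "nat \<Rightarrow> complex poly"
    where L: "\<And>p w. degree p \<le> j \<Longrightarrow> poly p w = (\<Sum>k\<le>j. poly p (of_nat k) * poly (L k) w)"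
    using lagrange_interpolation by blast
  \<comment> \<open>\<open>mix\<close> takes the coordinates in \<open>S\<close> from
    \<open>x\<close> and freezes the others at \<open>a\<close>. Induction over \<open>S\<close>
    frees one coordinate at a time, for every \<open>a\<close>.\<close>
  define mix where "mix S a x = (\<chi> i. if i \<in> S then x $ i else a $ i)" for S and a x :: "complex^'n"
  have "mpoly_fun (\<lambda>x. h (mix S a x))" for S a
    using finite [of S]
  proof (induction S arbitrary: a rule: finite_induct)
    case empty
    show ?case
      by (simp add: mix_def mpoly_fun.const)
  next
    case (insert i S)
    define upd where "upd a c = (\<chi> l. if l = i then c else a $ l)" for a :: "complex^'n" and c
    \<comment> \<open>As the \<open>i\<close>-th coordinate varies, the point runs along a line on
      which \<open>h\<close> has degree at most \<open>j\<close>. The interpolation values freeze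
      that coordinate at a node, where the induction hypothesis applies.\<close>
    have "h (mix (insert i S) a x) = (\<Sum>k\<le>j. h (mix S (upd a (of_nat k)) x) * poly (L k) (x $ i))" for x
    proof -
      obtain p where p: "degree p \<le> j" "\<And>w. h (mix S (upd a 0) x + w *s axis i 1) = poly p w"
        using assms by blast
      have eq: "mix S (upd a 0) x + w *s axis i 1 = mix S (upd a w) x" for w
        using insert(2) by (auto simp: vec_eq_iff mix_def upd_def axis_def)
      have "mix (insert i S) a x = mix S (upd a (x $ i)) x"
        using insert(2) by (auto simp: vec_eq_iff mix_def upd_def)
      then show ?thesis
        using L [OF p(1), of "x $ i"] by (simp add: p(2) [symmetric] eq)
    qed
    moreover have "mpoly_fun (\<lambda>x. \<Sum>k\<le>j. h (mix S (upd a (of_nat k)) x) * poly (L k) (x $ i))"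
      by (intro mpoly_fun_sum mpoly_fun_mult_poly insert.IH)
    ultimately show ?case
      by simp
  qed
  from this [of UNIV 0] show ?thesis
    by (simp add: mix_def)
qed

section \<open>Homogeneous expansions\<close>

lemma powser_sums_unique:
  fixes a b :: "nat \<Rightarrow> complex"
  assumes "0 < s" and a: "\<And>z. norm z < s \<Longrightarrow> (\<lambda>n. a n * z ^ n) sums f z"
    and b: "\<And>z. norm z < s \<Longrightarrow> (\<lambda>n. b n * z ^ n) sums f z"
  shows "a n = b n"
proof (rule ccontr)
  assume ne: "a n \<noteq> b n"
  have sums: "(\<lambda>n. (a n - b n) * z ^ n) sums 0" if "norm z < s" for z
    using sums_diff [OF a b, OF that that] by (simp add: left_diff_distrib)
  have "a 0 = b 0"
    using sums [of 0] \<open>0 < s\<close> by (simp add: powser_sums_zero_iff)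
  with ne have "n > 0"
    by (cases n) auto
  \<comment> \<open>Zeros of a nonzero power series are isolated, while the difference series
    vanishes on a whole disc. This form of the fact asks for a nonzero coefficient of positive
    index.\<close>
  then obtain t where "t > 0" "\<And>z :: complex. z \<in> cball 0 t - {0} \<Longrightarrow> (0 :: complex) \<noteq> 0"
    using powser_0_nonzero [OF \<open>0 < s\<close>, of 0 "\<lambda>n. a n - b n" "\<lambda>_. 0" n] sums ne by auto
  moreover have "complex_of_real t \<in> cball 0 t - {0}" if "t > 0" for t
    using that by simp
  ultimately show False
    by blast
qed

text \<open>On the complex line through \<open>x\<close>, both expansions become power series in
  \<open>z\<close>, with coefficients \<open>F j x\<close> and \<open>G j x\<close>.\<close>

lemma homogeneous_expansion_unique:
  fixes f :: "complex^'n \<Rightarrow> complex"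
  assumes "homogeneous_expansion f F" "homogeneous_expansion f G"
  shows "F = G"
proof (intro ext)
  fix j and x :: "complex^'n"
  have "\<forall>\<^sub>F y in nhds 0. (\<lambda>j. F j y) sums f y \<and> (\<lambda>j. G j y) sums f y"
    using assms by (simp add: homogeneous_expansion_def eventually_conj)
  then obtain e where "e > 0" and
    e: "\<And>y. norm y < e \<Longrightarrow> (\<lambda>j. F j y) sums f y \<and> (\<lambda>j. G j y) sums f y"
    unfolding eventually_nhds_metric by (auto simp: dist_norm)
  define s where "s = e / (norm x + 1)"
  have pos: "norm x + 1 > 0"
    by (simp add: add_nonneg_pos)
  have small: "norm (z *s x) < e" if "norm z < s" for z
  proof -
    have "norm z * norm x \<le> norm z * (norm x + 1)"
      by (simp add: mult_left_mono)
    also have "\<dots> < e"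
      using that pos by (simp add: s_def pos_less_divide_eq)
    finally show ?thesis
      by (simp add: norm_vector_scalar_mult)
  qed
  have "F j (z *s x) = F j x * z ^ j" "G j (z *s x) = G j x * z ^ j" for j z
    using homogeneous_polynomial_scalar_mult [of j "F j" z x]
      homogeneous_polynomial_scalar_mult [of j "G j" z x] assms
    by (simp_all add: homogeneous_expansion_def mult.commute)
  then have "norm z < s \<Longrightarrow> (\<lambda>j. F j x * z ^ j) sums f (z *s x)"
    "norm z < s \<Longrightarrow> (\<lambda>j. G j x * z ^ j) sums f (z *s x)" for z
    using e [OF small, of z] by simp_all
  then show "F j x = G j x"
    using powser_sums_unique [of s "\<lambda>j. F j x" "\<lambda>z. f (z *s x)" "\<lambda>j. G j x" j] \<open>e > 0\<close> pos
    by (simp add: s_def)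
qed

section \<open>Taylor components of a bounded holomorphic function on a closed ball\<close>

locale holomorphic_cball =
  fixes f :: "complex^'n \<Rightarrow> complex" and r M :: real
  assumes r_pos: "0 < r"
    and diff: "norm x \<le> r \<Longrightarrow> \<exists>L. (f has_derivative L) (at x) \<and> (\<forall>c v. L (c *s v) = c * L v)"
    and bound: "norm x \<le> r \<Longrightarrow> norm (f x) \<le> M"
begin

text \<open>The \<open>j\<close>-th Taylor coefficient at 0 of the restriction of \<open>f\<close>
  to the complex line through \<open>x\<close>. Only one-variable derivatives occur; that the result
  is polynomial in \<open>x\<close> is proved below.\<close>

definition taylor :: "nat \<Rightarrow> complex^'n \<Rightarrow> complex" where
  "taylor j x = (deriv ^^ j) (\<lambda>z. f (z *s x)) 0 / fact j"

text \<open>Chain rule: a complex linear derivative \<open>L\<close> of \<open>f\<close> yields the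
  one-variable derivative \<open>L v\<close>.\<close>

lemma holomorphic_line:
  assumes "\<And>z. z \<in> S \<Longrightarrow> norm (a + z *s v) \<le> r"
  shows "(\<lambda>z. f (a + z *s v)) holomorphic_on S"
proof
  fix z assume "z \<in> S"
  then obtain L where L: "(f has_derivative L) (at (a + z *s v))" "\<And>c v. L (c *s v) = c * L v"
    using diff assms by blast
  have "((\<lambda>z. a + z *s v) has_derivative (\<lambda>h. h *s v)) (at z within S)"
    using has_derivative_add [OF has_derivative_const [of a]
        bounded_linear.has_derivative [OF bounded_linear_vector_scalar_mult has_derivative_ident]]
    by simp
  note has_derivative_compose [OF this L(1)]
  moreover have "(\<lambda>h. L (h *s v)) = (*) (L v)"
    by (simp add: fun_eq_iff L(2) mult.commute)
  ultimately have "((\<lambda>z. f (a + z *s v)) has_field_derivative L v) (at z within S)"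
    by (simp add: has_field_derivative_def)
  then show "(\<lambda>z. f (a + z *s v)) field_differentiable at z within S"
    using field_differentiable_def by blast
qed

lemma M_nonneg: "0 \<le> M"
  using order_trans [OF norm_ge_zero bound [of 0]] r_pos by simp

lemma taylor_sums:
  assumes "norm z * norm x < r"
  shows "(\<lambda>j. taylor j x * z ^ j) sums f (z *s x)"
proof -
  \<comment> \<open>A radius exceeding \<open>norm z\<close> for which the disc on the line stays in
    the ball; for \<open>x = 0\<close> every radius will do.\<close>
  obtain \<rho> where \<rho>: "norm z < \<rho>" "\<rho> * norm x \<le> r"
  proof (cases "x = 0")
    case True
    then show ?thesis
      using that [of "norm z + 1"] r_pos by simp
  next
    case False
    then show ?thesis
      using that [of "r / norm x"] assms by (simp add: pos_less_divide_eq)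
  qed
  have "(\<lambda>z. f (0 + z *s x)) holomorphic_on ball 0 \<rho>"
  proof (rule holomorphic_line)
    fix w :: complex assume "w \<in> ball 0 \<rho>"
    then have "norm w * norm x \<le> \<rho> * norm x"
      by (intro mult_right_mono) auto
    then show "norm (0 + w *s x) \<le> r"
      using \<rho> by (simp add: norm_vector_scalar_mult)
  qed
  then show ?thesis
    using holomorphic_power_series [of "\<lambda>z. f (z *s x)" 0 \<rho> z] \<rho>(1)
    by (simp add: taylor_def)
qed

text \<open>The function \<open>f (z *s (c *s x))\<close> of \<open>z\<close> has two power series,
  one from the line through \<open>c *s x\<close> and one from the line through \<open>x\<close> at
  \<open>z * c\<close>; their coefficients agree.\<close>

lemma taylor_scalar_mult: "taylor j (c *s x) = c ^ j * taylor j x"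
proof -
  define s where "s = r / ((norm c + 1) * (norm x + 1))"
  have pos: "(norm c + 1) * (norm x + 1) > 0"
    by (intro mult_pos_pos add_nonneg_pos) auto
  have small: "norm z * (norm c * norm x) < r" if "norm z < s" for z
  proof -
    have "norm z * (norm c * norm x) \<le> norm z * ((norm c + 1) * (norm x + 1))"
      by (intro mult_left_mono mult_mono) auto
    also have "\<dots> < r"
      using that pos by (simp add: s_def pos_less_divide_eq)
    finally show ?thesis .
  qed
  have "norm z < s \<Longrightarrow> (\<lambda>j. taylor j (c *s x) * z ^ j) sums f (z *s (c *s x))" for z
    by (rule taylor_sums) (simp add: small norm_vector_scalar_mult)
  moreover have "norm z < s \<Longrightarrow> (\<lambda>j. (c ^ j * taylor j x) * z ^ j) sums f (z *s (c *s x))" for z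
    using taylor_sums [of "z * c" x] small [of z]
    by (simp add: norm_mult mult_ac power_mult_distrib)
  moreover have "s > 0"
    using pos r_pos by (simp add: s_def)
  ultimately show ?thesis
    using powser_sums_unique [of s "\<lambda>j. taylor j (c *s x)" "\<lambda>z. f (z *s (c *s x))"
        "\<lambda>j. c ^ j * taylor j x" j]
    by simp
qed

text \<open>Cauchy's inequality on the disc of radius \<open>r / norm x\<close>, which the line
  through \<open>x\<close> maps into the closed ball where \<open>M\<close> bounds \<open>f\<close>.
  At \<open>x = 0\<close>, components of positive degree vanish by homogeneity.\<close>

lemma norm_taylor_le: "norm (taylor j x) \<le> M * (norm x / r) ^ j"
proof (cases "x = 0")
  case True
  show ?thesis
  proof (cases j)
    case 0
    then show ?thesis
      using True bound [of 0] r_pos by (simp add: taylor_def)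
  next
    case (Suc i)
    then show ?thesis
      using taylor_scalar_mult [of j 0 x] True by simp
  qed
next
  case False
  define \<rho> where "\<rho> = r / norm x"
  have "\<rho> > 0"
    using False r_pos by (simp add: \<rho>_def)
  have small: "norm (z *s x) \<le> r" if "norm z \<le> \<rho>" for z
    using that False by (simp add: norm_vector_scalar_mult \<rho>_def pos_le_divide_eq)
  have "norm ((deriv ^^ j) (\<lambda>z. f (z *s x)) 0) \<le> fact j * M / \<rho> ^ j"
  proof (rule Cauchy_inequality)
    have "(\<lambda>z. f (0 + z *s x)) holomorphic_on cball 0 \<rho>"
      by (rule holomorphic_line) (simp add: small)
    then have holo: "(\<lambda>z. f (z *s x)) holomorphic_on cball 0 \<rho>"
      by simp
    show "(\<lambda>z. f (z *s x)) holomorphic_on ball 0 \<rho>"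
      by (rule holomorphic_on_subset [OF holo ball_subset_cball])
    show "continuous_on (cball 0 \<rho>) (\<lambda>z. f (z *s x))"
      by (rule holomorphic_on_imp_continuous_on [OF holo])
    show "norm (f (z *s x)) \<le> M" if "norm (0 - z) = \<rho>" for z
      using that by (intro bound small) simp
  qed fact
  then have "norm (taylor j x) \<le> M / \<rho> ^ j"
    by (simp add: taylor_def norm_divide pos_divide_le_eq mult.commute)
  then show ?thesis
    by (simp add: \<rho>_def power_divide)
qed

text \<open>The tail is dominated by a geometric series of ratio \<open>norm x / r\<close>; as this
  is at most 1/2, summation costs a factor 2.\<close>

lemma taylor_remainder:
  assumes "norm x \<le> r / 2"
  shows "norm (f x - (\<Sum>l<j. taylor l x)) \<le> 2 * M * (norm x / r) ^ j"
proof -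
  define q where "q = norm x / r"
  have q: "0 \<le> q" "q \<le> 1 / 2"
    using assms r_pos by (auto simp: q_def field_simps)
  have "norm x < r"
    using assms r_pos by simp
  then have "(\<lambda>l. taylor l x) sums f x"
    using taylor_sums [of 1 x] by simp
  then have "(\<lambda>l. taylor (l + j) x) sums (f x - (\<Sum>l<j. taylor l x))"
    using sums_iff_shift [of "\<lambda>l. taylor l x" j] by simp
  moreover have "(\<lambda>l. (M * q ^ j) * q ^ l) sums ((M * q ^ j) * (1 / (1 - q)))"
    using q by (intro sums_mult geometric_sums) auto
  moreover have "norm (taylor (l + j) x) \<le> (M * q ^ j) * q ^ l" for l
    using norm_taylor_le [of "l + j" x] by (simp add: q_def power_add mult_ac)
  ultimately have "norm (f x - (\<Sum>l<j. taylor l x)) \<le> (M * q ^ j) * (1 / (1 - q))"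
    using norm_sums_le by blast
  also have "\<dots> \<le> (M * q ^ j) * 2"
    using q M_nonneg by (intro mult_left_mono) (auto simp: field_simps)
  finally show ?thesis
    by (simp add: q_def mult.commute mult.left_commute)
qed

text \<open>By the previous estimate, \<open>taylor j\<close> is the locally uniform limit of
  \<open>x \<mapsto> (f (x / n) - (\<Sum>l<j. taylor l (x / n))) n\<^sup>j\<close>.\<close>

lemma holomorphic_on_taylor_line: "(\<lambda>z. taylor j (a + z *s v)) holomorphic_on UNIV"
proof (induction j rule: less_induct)
  case (less j)
  have "(\<lambda>z. taylor j (a + z *s v)) holomorphic_on ball 0 R" if "R > 0" for R
  proof -
    define C where "C = norm a + R * norm v"
    have C: "norm (a + z *s v) \<le> C" if "z \<in> cball 0 R" for z
    proof -
      have "norm (a + z *s v) \<le> norm a + norm z * norm v"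
        by (metis norm_triangle_ineq norm_vector_scalar_mult)
      also have "\<dots> \<le> C"
        unfolding C_def using that by (intro add_left_mono mult_right_mono) auto
      finally show ?thesis .
    qed
    have "C \<ge> 0"
      using that by (simp add: C_def)
    \<comment> \<open>The scaling factor is 0 at \<open>n = 0\<close>, hence the condition
      \<open>n > 0\<close> below.\<close>
    define c where "c n = inverse (of_nat n :: complex)" for n
    define A where "A n z = (f (c n *s (a + z *s v)) - (\<Sum>l<j. taylor l (c n *s (a + z *s v)))) / c n ^ j"
      for n z
    have lim: "(\<lambda>n. norm (c n) * B) \<longlonglongrightarrow> 0" for B
      unfolding c_def by (intro tendsto_mult_left_zero tendsto_norm_zero lim_inverse_n)
    have ev: "\<forall>\<^sub>F n in sequentially. norm (c n) * C < r / 2"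
      using r_pos by (intro order_tendstoD(2) [OF lim]) simp
    have ev_small: "\<forall>\<^sub>F n in sequentially. n > 0 \<and> (\<forall>z\<in>cball 0 R. norm (c n *s (a + z *s v)) \<le> r / 2)"
      using ev eventually_gt_at_top [of 0]
    proof eventually_elim
      case (elim n)
      have "norm (c n *s (a + z *s v)) \<le> r / 2" if "z \<in> cball 0 R" for z
        using mult_left_mono [OF C [OF that], of "norm (c n)"] elim
        unfolding norm_vector_scalar_mult by simp
      then show ?case
        using elim by blast
    qed
    have "\<forall>\<^sub>F n in sequentially. continuous_on (cball 0 R) (A n) \<and> A n holomorphic_on ball 0 R"
      using ev_small
    proof eventually_elim
      case (elim n)
      have "n > 0"
        using elim by blast
      then have nz: "c n \<noteq> 0"
        by (simp add: c_def)
      have eq: "c n *s (a + z *s v) = c n *s a + z *s (c n *s v)" for z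
        by (simp add: vec_eq_iff algebra_simps)
      have "norm (c n *s a + z *s (c n *s v)) \<le> r" if "z \<in> cball 0 R" for z
      proof -
        have "norm (c n *s (a + z *s v)) \<le> r / 2"
          using elim that by blast
        then show ?thesis
          using r_pos unfolding eq by linarith
      qed
      then have "(\<lambda>z. f (c n *s (a + z *s v))) holomorphic_on cball 0 R"
        unfolding eq by (rule holomorphic_line)
      \<comment> \<open>The subtracted components have degree below \<open>j\<close>, so the
        induction hypothesis applies to them.\<close>
      moreover have "(\<lambda>z. \<Sum>l<j. c n ^ l * taylor l (a + z *s v)) holomorphic_on cball 0 R"
        by (intro holomorphic_on_sum holomorphic_on_mult holomorphic_on_const
            holomorphic_on_subset [OF less] subset_UNIV) (rule lessThan_iff [THEN iffD1])
      ultimately have "A n holomorphic_on cball 0 R"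
        unfolding A_def taylor_scalar_mult using nz
        by (intro holomorphic_on_divide holomorphic_on_diff holomorphic_on_const) simp_all
      then show ?case
        using holomorphic_on_subset [OF _ ball_subset_cball] holomorphic_on_imp_continuous_on by auto
    qed
    moreover have "uniform_limit (cball 0 R) A (\<lambda>z. taylor j (a + z *s v)) sequentially"
    proof (rule uniform_limitI)
      fix e :: real assume "e > 0"
      \<comment> \<open>The remainder has order \<open>Suc j\<close>, so one factor
        \<open>norm (c n)\<close> survives division by \<open>c n ^ j\<close>; \<open>B\<close>
        bounds what it multiplies.\<close>
      define B where "B = 2 * M * (C / r) ^ Suc j"
      have "\<forall>\<^sub>F n in sequentially. norm (c n) * B < e"
        using order_tendstoD(2) [OF lim] \<open>e > 0\<close> by simp
      with ev_small
      show "\<forall>\<^sub>F n in sequentially. \<forall>z\<in>cball 0 R. dist (A n z) (taylor j (a + z *s v)) < e"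
      proof eventually_elim
        case (elim n)
        show ?case
        proof
          fix z :: complex assume z: "z \<in> cball 0 R"
          define y where "y = a + z *s v"
          have "n > 0" and small: "norm (c n *s y) \<le> r / 2"
            using elim(1) z unfolding y_def by blast+
          then have nz: "c n \<noteq> 0"
            by (simp add: c_def)
          \<comment> \<open>By homogeneity, \<open>taylor j y\<close> is the term
            \<open>l = j\<close> divided by \<open>c n ^ j\<close>, so it joins the subtracted
            sum.\<close>
          have "A n z - taylor j y = (f (c n *s y) - (\<Sum>l<Suc j. taylor l (c n *s y))) / c n ^ j"
            unfolding A_def y_def [symmetric] using nz
            by (simp add: taylor_scalar_mult [of j] diff_divide_distrib add_divide_distrib)
          then have "dist (A n z) (taylor j y) = norm (f (c n *s y) - (\<Sum>l<Suc j. taylor l (c n *s y))) / norm (c n) ^ j"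
            by (simp only: dist_norm norm_divide norm_power)
          also have "\<dots> \<le> (2 * M * (norm (c n *s y) / r) ^ Suc j) / norm (c n) ^ j"
            using small by (intro divide_right_mono taylor_remainder) auto
          also have "\<dots> = norm (c n) * (2 * M * (norm y / r) ^ Suc j)"
          proof -
            have "norm (c n *s y) / r = norm (c n) * (norm y / r)"
              by (simp add: norm_vector_scalar_mult)
            then show ?thesis
              using nz by (simp add: power_mult_distrib del: times_divide_eq_right)
          qed
          also have "\<dots> \<le> norm (c n) * B"
            unfolding B_def using C [OF z] r_pos M_nonneg
            by (intro mult_left_mono power_mono divide_right_mono) (auto simp: y_def)
          finally show "dist (A n z) (taylor j (a + z *s v)) < e"
            using elim(2) by (simp only: y_def)
        qed
      qed
    qed
    ultimately show ?thesis
      by (rule holomorphic_uniform_limit) auto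
  qed
  note holo = this
  have "(\<lambda>z. taylor j (a + z *s v)) field_differentiable at z" for z
    using holo [of "norm z + 1"]
    by (rule holomorphic_on_imp_differentiable_at) (auto simp: add_nonneg_pos)
  then show ?case
    by (simp add: holomorphic_on_def)
qed

text \<open>Liouville: on a line, \<open>taylor j\<close> is entire and grows at most like the \<open>j\<close>-th power.\<close>

lemma taylor_polynomial_line: "\<exists>p. degree p \<le> j \<and> (\<forall>z. taylor j (a + z *s v) = poly p z)"
proof -
  define h where "h z = taylor j (a + z *s v)" for z
  have bound: "norm (h z) \<le> M * ((norm a + norm v) / r) ^ j * norm z ^ j" if "1 \<le> norm z" for z
  proof -
    have "norm (a + z *s v) \<le> norm a + norm z * norm v"
      by (metis norm_triangle_ineq norm_vector_scalar_mult)
    \<comment> \<open>For \<open>1 \<le> norm z\<close> the constant term may be enlarged, which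
      leaves a multiple of a pure power of \<open>norm z\<close>.\<close>
    also have "\<dots> \<le> norm z * norm a + norm z * norm v"
      using mult_right_mono [OF that, of "norm a"] by simp
    finally have "norm (a + z *s v) / r \<le> (norm a + norm v) / r * norm z"
      using r_pos by (simp add: field_simps)
    then have "(norm (a + z *s v) / r) ^ j \<le> ((norm a + norm v) / r * norm z) ^ j"
      using r_pos by (intro power_mono) auto
    then have "M * (norm (a + z *s v) / r) ^ j \<le> M * ((norm a + norm v) / r * norm z) ^ j"
      using M_nonneg by (intro mult_left_mono)
    then show ?thesis
      unfolding h_def using norm_taylor_le [of j "a + z *s v"] by (simp only: power_mult_distrib mult.assoc)
  qed
  have "h z = (\<Sum>k\<le>j. (deriv ^^ k) h 0 / fact k * z ^ k)" for z
    using holomorphic_on_taylor_line bound unfolding h_def by (rule Liouville_polynomial)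
  then have "h z = poly (\<Sum>k\<le>j. monom ((deriv ^^ k) h 0 / fact k) k) z" for z
    by (simp add: poly_sum poly_monom)
  moreover have "degree (\<Sum>k\<le>j. monom ((deriv ^^ k) h 0 / fact k) k) \<le> j"
    by (intro degree_sum_le) (auto intro: order_trans [OF degree_monom_le])
  ultimately show ?thesis
    unfolding h_def by blast
qed

text \<open>A common degree bound on all lines gives a polynomial function; scaling then singles out
  the degree \<open>j\<close>.\<close>

lemma homogeneous_polynomial_taylor: "homogeneous_polynomial j (taylor j)"
  by (rule homogeneous_polynomial_if_mpoly_fun [OF mpoly_fun_if_polynomial_on_lines [of j]])
     (fact taylor_polynomial_line taylor_scalar_mult)+

lemma homogeneous_expansion_taylor: "homogeneous_expansion f taylor"
proof -
  have "(\<lambda>j. taylor j x) sums f x" if "norm x < r" for x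
    using taylor_sums [of 1 x] that by simp
  then show ?thesis
    unfolding homogeneous_expansion_def eventually_nhds_metric
    using homogeneous_polynomial_taylor r_pos by (auto simp: dist_norm)
qed

lemma homogeneous_component_eq: "homogeneous_component f = taylor"
  unfolding homogeneous_component_def
  using homogeneous_expansion_taylor homogeneous_expansion_unique by blast

end

lemma holomorphic_germ_imp_holomorphic_cball:
  fixes f :: "complex^'n \<Rightarrow> complex"
  assumes "holomorphic_germ f"
  obtains r M where "holomorphic_cball f r M"
proof -
  obtain U where U: "open U" "0 \<in> U"
    and diff: "\<And>x. x \<in> U \<Longrightarrow> \<exists>L. (f has_derivative L) (at x) \<and> (\<forall>c v. L (c *s v) = c * L v)"
    using assms unfolding holomorphic_germ_def by blast
  obtain r where "r > 0" and r: "cball 0 r \<subseteq> U"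
    using U open_contains_cball by blast
  have "continuous_on (cball 0 r) f"
    using r diff by (intro continuous_at_imp_continuous_on) (blast dest: has_derivative_continuous)
  then have "bounded (f ` cball 0 r)"
    by (intro compact_imp_bounded compact_continuous_image) auto
  then obtain M where "\<And>x. x \<in> cball 0 r \<Longrightarrow> norm (f x) \<le> M"
    unfolding bounded_iff by blast
  then have "holomorphic_cball f r M"
    using \<open>r > 0\<close> r by unfold_locales (auto intro!: diff)
  then show ?thesis
    using that by blast
qed

section \<open>Initial forms\<close>

text \<open>Points of the blow-up converging to the point \<open>(x, 0)\<close> of the exceptional sphere from
  off that sphere.\<close>

definition exceptional_filter :: "'a::real_normed_vector \<Rightarrow> ('a \<times> real) filter" where
  "exceptional_filter x = at (x, 0) within sphere 0 1 \<times> {0<..}"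

text \<open>This makes limits along the filter unique; the points \<open>(x, e / 2)\<close> approach
  \<open>(x, 0)\<close>.\<close>

lemma exceptional_filter_neq_bot:
  assumes "norm x = 1"
  shows "exceptional_filter x \<noteq> bot"
proof -
  have "(x, 0) islimpt sphere 0 1 \<times> {0 :: real<..}"
    unfolding islimpt_approachable
  proof (intro allI impI)
    fix e :: real assume "e > 0"
    then show "\<exists>p \<in> sphere 0 1 \<times> {0 :: real<..}. p \<noteq> (x, 0) \<and> dist p (x, 0) < e"
      using assms by (intro bexI [where x = "(x, e / 2)"] conjI) (auto simp: dist_Pair_Pair)
  qed
  then show ?thesis
    unfolding exceptional_filter_def by (simp add: trivial_limit_within)
qed

lemma eventually_exceptional_filter_in:
  "\<forall>\<^sub>F p in exceptional_filter x. fst p \<in> sphere 0 1 \<and> snd p > 0"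
  unfolding exceptional_filter_def eventually_at_topological by auto

lemma tendsto_exceptional_filter: "((\<lambda>p. p) \<longlongrightarrow> (x, 0)) (exceptional_filter x)"
  unfolding exceptional_filter_def by (rule tendsto_ident_at)

lemmas tendsto_fst_exceptional_filter = tendsto_fst [OF tendsto_exceptional_filter, simplified]
lemmas tendsto_snd_exceptional_filter = tendsto_snd [OF tendsto_exceptional_filter, simplified]

lemma tendsto_spherical_blowup_exceptional_filter:
  "(spherical_blowup \<longlongrightarrow> 0) (exceptional_filter x)"
  unfolding spherical_blowup_def case_prod_unfold
  using tendsto_scaleR [OF tendsto_snd_exceptional_filter tendsto_fst_exceptional_filter] by simp

text \<open>The data about \<open>f\<close> that the comparison uses: approximation by a form
  \<open>h\<close> up to order \<open>Suc m\<close>, and holomorphy on lines for Hurwitz' theorem.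
  Positivity of \<open>m\<close> makes \<open>h\<close> vanish at 0 and permits \<open>m\<close>-th
  roots.\<close>

locale leading_form =
  fixes f h :: "complex^'n \<Rightarrow> complex" and m :: nat and r C :: real
  assumes m_pos: "0 < m" and r_pos: "0 < r" and C_nonneg: "0 \<le> C"
    and homogeneous: "homogeneous_polynomial m h" and nonzero: "\<exists>x. h x \<noteq> 0"
    and remainder: "norm x \<le> r \<Longrightarrow> norm (f x - h x) \<le> C * norm x ^ Suc m"
    and holomorphic_line:
      "(\<And>z. z \<in> S \<Longrightarrow> norm (a + z *s v) \<le> r) \<Longrightarrow> (\<lambda>z. f (a + z *s v)) holomorphic_on S"
begin

lemma scaleR_eq: "h (t *\<^sub>R x) = of_real t ^ m * h x"
  by (simp only: vector_scaleR_eq_scalar_mult homogeneous_polynomial_scalar_mult [OF homogeneous])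

lemma rescaled_remainder:
  assumes "0 < t" "t * norm x \<le> r"
  shows "norm (f (t *\<^sub>R x) / of_real t ^ m - h x) \<le> t * (C * norm x ^ Suc m)"
proof -
  have "f (t *\<^sub>R x) / of_real t ^ m - h x = (f (t *\<^sub>R x) - h (t *\<^sub>R x)) / of_real t ^ m"
    using assms by (simp add: scaleR_eq diff_divide_distrib)
  then have "norm (f (t *\<^sub>R x) / of_real t ^ m - h x) = norm (f (t *\<^sub>R x) - h (t *\<^sub>R x)) / t ^ m"
    using assms by (simp add: norm_divide norm_power)
  also have "\<dots> \<le> C * norm (t *\<^sub>R x) ^ Suc m / t ^ m"
    using assms by (intro divide_right_mono remainder) auto
  also have "\<dots> = t * (C * norm x ^ Suc m)"
    using assms by (simp add: power_mult_distrib)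
  finally show ?thesis .
qed

text \<open>Direction and radius vary together: the rescaled error tends to 0 uniformly on the
  sphere, and \<open>h\<close> is continuous in the direction.\<close>

lemma tendsto_rescaled:
  "((\<lambda>p. f (spherical_blowup p) / of_real (snd p) ^ m) \<longlongrightarrow> h x) (exceptional_filter x)"
proof -
  have "((\<lambda>p. f (spherical_blowup p) / of_real (snd p) ^ m - h (fst p)) \<longlongrightarrow> 0) (exceptional_filter x)"
  proof (rule Lim_null_comparison)
    have "\<forall>\<^sub>F p in exceptional_filter x. snd p < r"
      using r_pos by (intro order_tendstoD(2) [OF tendsto_snd_exceptional_filter])
    then show "\<forall>\<^sub>F p in exceptional_filter x.
        norm (f (spherical_blowup p) / of_real (snd p) ^ m - h (fst p)) \<le> snd p * C"
      using eventually_exceptional_filter_in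
    proof eventually_elim
      case (elim p)
      then show ?case
        using rescaled_remainder [of "snd p" "fst p"] by (simp add: spherical_blowup_def case_prod_unfold)
    qed
    show "((\<lambda>p. snd p * C) \<longlongrightarrow> 0) (exceptional_filter x)"
      using tendsto_mult_left_zero [OF tendsto_snd_exceptional_filter] .
  qed
  moreover have "isCont h x"
    using continuous_on_homogeneous_polynomial [OF homogeneous, of UNIV]
    by (simp add: continuous_on_eq_continuous_at)
  then have "((\<lambda>p. h (fst p)) \<longlongrightarrow> h x) (exceptional_filter x)"
    using tendsto_fst_exceptional_filter by (rule isCont_tendsto_compose)
  ultimately show ?thesis
    using tendsto_add by fastforce
qed

text \<open>Hurwitz' theorem on a complex line through \<open>x\<close> on which \<open>h\<close> does not vanish identically.\<close>

lemma initial_form_nonzero: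
  assumes "norm x = 1" and ev: "\<forall>\<^sub>F p in exceptional_filter x. f (spherical_blowup p) \<noteq> 0"
  shows "h x \<noteq> 0"
proof -
  \<comment> \<open>\<open>N\<close> also allows directions off the unit sphere, since the complex
    line used below leaves it.\<close>
  define N :: "((complex^'n) \<times> real) filter" where "N = at (x, 0) within (- {0}) \<times> {0<..}"
  have "x \<noteq> 0"
    using assms(1) by auto
  have id: "((\<lambda>p. p) \<longlongrightarrow> (x, 0)) N"
    unfolding N_def by (rule tendsto_ident_at)
  \<comment> \<open>Normalising the direction and multiplying the radius by its norm keeps the
    blown-down point, so absence of zeros carries over to \<open>N\<close>.\<close>
  have "((\<lambda>p. (sgn (fst p), snd p * norm (fst p))) \<longlongrightarrow> (sgn x, 0 * norm x)) N"
    using tendsto_fst [OF id] tendsto_snd [OF id] \<open>x \<noteq> 0\<close> by (intro tendsto_intros) auto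
  then have lim: "((\<lambda>p. (sgn (fst p), snd p * norm (fst p))) \<longlongrightarrow> (x, 0)) N"
    using assms(1) by (simp add: sgn_div_norm)
  have in_N: "\<forall>\<^sub>F p in N. fst p \<noteq> 0 \<and> snd p > 0"
    unfolding N_def eventually_at_topological by auto
  then have "\<forall>\<^sub>F p in N. (sgn (fst p), snd p * norm (fst p)) \<in> sphere 0 1 \<times> {0<..} \<and>
      (sgn (fst p), snd p * norm (fst p)) \<noteq> (x, 0)"
    by eventually_elim (auto simp: norm_sgn)
  with lim have "filterlim (\<lambda>p. (sgn (fst p), snd p * norm (fst p))) (exceptional_filter x) N"
    unfolding exceptional_filter_def filterlim_at by blast
  from eventually_compose_filterlim [OF ev this] in_N
  have "\<forall>\<^sub>F p in N. f (snd p *\<^sub>R fst p) \<noteq> 0"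
    by eventually_elim (simp add: spherical_blowup_def sgn_div_norm mult.assoc)
  then obtain d where "d > 0"
    and d: "\<And>p. p \<in> (- {0}) \<times> {0<..} \<Longrightarrow> p \<noteq> (x, 0) \<Longrightarrow> dist p (x, 0) < d \<Longrightarrow> f (snd p *\<^sub>R fst p) \<noteq> 0"
    unfolding N_def eventually_at by blast
  \<comment> \<open>The bound 1/2 keeps points near the unit vector \<open>x\<close> away from 0;
    \<open>d / 2\<close> leaves half of \<open>d\<close> each to direction and radius.\<close>
  define \<delta> where "\<delta> = min (d / 2) (1 / 2)"
  have "\<delta> > 0" and \<delta>: "\<delta> \<le> d / 2" "\<delta> \<le> 1 / 2"
    using \<open>d > 0\<close> by (auto simp: \<delta>_def)
  have nz: "f (t *\<^sub>R y) \<noteq> 0" if "norm (y - x) < \<delta>" "0 < t" "t < \<delta>" for y t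
  proof -
    have "y \<noteq> 0"
      using that \<delta>(2) assms(1) by auto
    have "dist (y, t) (x, 0) \<le> dist y x + dist t 0"
      unfolding dist_Pair_Pair by (rule sqrt_sum_squares_le_sum) auto
    also have "\<dots> < d"
      using that \<delta>(1) by (simp add: dist_norm)
    finally show ?thesis
      using d [of "(y, t)"] \<open>y \<noteq> 0\<close> that by simp
  qed
  obtain p where "h p \<noteq> 0"
    using nonzero by blast
  \<comment> \<open>The line reaches \<open>p\<close> at parameter 1, so \<open>h\<close> does not
    vanish identically on it.\<close>
  define v where "v = p - x"
  define \<epsilon> where "\<epsilon> = \<delta> / (norm v + 1)"
  have pos: "norm v + 1 > 0"
    by (simp add: add_nonneg_pos)
  then have "\<epsilon> > 0"
    using \<open>\<delta> > 0\<close> by (simp add: \<epsilon>_def)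
  have near: "norm (z *s v) < \<delta>" if "z \<in> ball 0 \<epsilon>" for z
  proof -
    have "norm z * norm v \<le> norm z * (norm v + 1)"
      by (simp add: mult_left_mono)
    also have "\<dots> < \<delta>"
      using that pos by (simp add: \<epsilon>_def pos_less_divide_eq)
    finally show ?thesis
      by (simp add: norm_vector_scalar_mult)
  qed
  have le_2: "norm (x + z *s v) \<le> 2" if "z \<in> ball 0 \<epsilon>" for z
    using norm_triangle_ineq [of x "z *s v"] near [OF that] \<delta>(2) assms(1) by linarith
  \<comment> \<open>Radii tending to 0, below \<open>\<delta>\<close> to exclude zeros of
    \<open>f\<close>, and at most \<open>r / 2\<close> because the points of the disc have norm at
    most 2.\<close>
  define t where "t n = min (\<delta> / 2) (r / 2) / real (Suc n)" for n
  have t_bound: "0 < t n" "t n < \<delta>" "t n \<le> r / 2" for n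
  proof -
    have min: "0 < min (\<delta> / 2) (r / 2)"
      using \<open>\<delta> > 0\<close> r_pos by simp
    then show "0 < t n"
      by (simp add: t_def)
    have "t n \<le> min (\<delta> / 2) (r / 2) / 1"
      unfolding t_def using min by (intro divide_left_mono) auto
    then show "t n < \<delta>" "t n \<le> r / 2"
      using \<open>\<delta> > 0\<close> by auto
  qed
  have t_small: "t n * norm (x + z *s v) \<le> r" if "z \<in> ball 0 \<epsilon>" for n z
    using mult_mono [OF t_bound(3) [of n] le_2 [OF that]] r_pos by simp
  have t_lim: "(\<lambda>n. t n * B) \<longlonglongrightarrow> 0" for B
    unfolding t_def by (intro tendsto_mult_left_zero LIMSEQ_Suc lim_const_over_n)
  define G where "G n z = f (t n *\<^sub>R (x + z *s v)) / of_real (t n) ^ m" for n z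
  define H where "H z = h (x + z *s v)" for z
  have holo_H: "H holomorphic_on S" for S
    unfolding H_def by (rule holomorphic_on_homogeneous_polynomial_line [OF homogeneous])
  have holo_G: "G n holomorphic_on ball 0 \<epsilon>" for n
  proof -
    have eq: "t n *\<^sub>R (x + z *s v) = t n *\<^sub>R x + z *s (t n *\<^sub>R v)" for z
      by (simp add: vec_eq_iff algebra_simps)
    have "norm (t n *\<^sub>R x + z *s (t n *\<^sub>R v)) \<le> r" if "z \<in> ball 0 \<epsilon>" for z
      using t_small [OF that, of n] t_bound(1) [of n] unfolding eq [symmetric] by simp
    then have "(\<lambda>z. f (t n *\<^sub>R (x + z *s v))) holomorphic_on ball 0 \<epsilon>"
      unfolding eq by (rule holomorphic_line)
    then show ?thesis
      unfolding G_def using t_bound(1) [of n] by (intro holomorphic_on_divide holomorphic_on_const) auto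
  qed
  have unif: "uniform_limit K G H sequentially" if "K \<subseteq> ball 0 \<epsilon>" for K
  proof (rule uniform_limitI)
    fix e :: real assume "e > 0"
    have "\<forall>\<^sub>F n in sequentially. t n * (C * 2 ^ Suc m) < e"
      using \<open>e > 0\<close> by (rule order_tendstoD(2) [OF t_lim])
    then show "\<forall>\<^sub>F n in sequentially. \<forall>z\<in>K. dist (G n z) (H z) < e"
    proof eventually_elim
      case (elim n)
      show ?case
      proof
        fix z assume "z \<in> K"
        then have z: "z \<in> ball 0 \<epsilon>"
          using that by blast
        have "dist (G n z) (H z) \<le> t n * (C * norm (x + z *s v) ^ Suc m)"
          unfolding G_def H_def dist_norm by (rule rescaled_remainder [OF t_bound(1) t_small [OF z]])
        also have "\<dots> \<le> t n * (C * 2 ^ Suc m)"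
          using t_bound(1) [of n] C_nonneg le_2 [OF z] by (intro mult_left_mono power_mono) auto
        finally show "dist (G n z) (H z) < e"
          using elim by linarith
      qed
    qed
  qed
  show ?thesis
  proof (cases "H constant_on ball 0 \<epsilon>")
    case True
    then obtain k where k: "\<And>z. z \<in> ball 0 \<epsilon> \<Longrightarrow> H z = k"
      unfolding constant_on_def by blast
    \<comment> \<open>By the identity theorem, constancy spreads from the disc to the whole line, so
      \<open>h x = h p\<close>.\<close>
    have "H 1 - H 0 = 0"
    proof (rule analytic_continuation [of "\<lambda>z. H z - H 0" UNIV "ball 0 \<epsilon>" 0])
      show "(\<lambda>z. H z - H 0) holomorphic_on UNIV"
        by (intro holomorphic_on_diff holo_H holomorphic_on_const)
      show "0 islimpt ball (0 :: complex) \<epsilon>"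
        using \<open>\<epsilon> > 0\<close> by (simp add: islimpt_ball)
      show "H z - H 0 = 0" if "z \<in> ball 0 \<epsilon>" for z
        using k [OF that] k [of 0] \<open>\<epsilon> > 0\<close> by simp
    qed auto
    then show ?thesis
      using \<open>h p \<noteq> 0\<close> by (simp add: H_def v_def)
  next
    case False
    have "H 0 \<noteq> 0"
    proof (rule Hurwitz_no_zeros [of "ball 0 \<epsilon>" G H 0])
      show "G n z \<noteq> 0" if "z \<in> ball 0 \<epsilon>" for n z
        unfolding G_def using nz [of "x + z *s v" "t n"] near [OF that] t_bound [of n] by simp
    qed (use holo_G holo_H unif False \<open>\<epsilon> > 0\<close> in auto)
    then show ?thesis
      by (simp add: H_def)
  qed
qed

text \<open>Moving along a ray from 0 multiplies \<open>h\<close> by positive numbers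
  \<open>t ^ m\<close>. So a ray meets the fibre exactly when \<open>h\<close> is positive along it,
  and then only once. Positivity is written \<open>sgn (h x) = 1\<close>.\<close>

lemma milnor_fibre_homeomorphic: "milnor_fibre h homeomorphic {x \<in> sphere 0 1. sgn (h x) = 1}"
proof (rule homeomorphicI)
  have h0: "h 0 = 0"
    using scaleR_eq [of 0 0] m_pos by (auto simp: power_0_left)
  \<comment> \<open>The inverse of radial projection: division by the \<open>m\<close>-th root of
    \<open>norm (h y)\<close> makes the value 1.\<close>
  define \<rho> where "\<rho> y = inverse (root m (norm (h y))) *\<^sub>R y" for y
  have sgn_in: "sgn x \<in> sphere 0 1" "sgn (h (sgn x)) = 1" "\<rho> (sgn x) = x" if "h x = 1" for x
  proof -
    have "x \<noteq> 0"
      using that h0 by auto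
    then show "sgn x \<in> sphere 0 1"
      by (simp add: norm_sgn)
    have h_sgn: "h (sgn x) = of_real (inverse (norm x) ^ m)"
      using that by (simp add: sgn_div_norm scaleR_eq)
    have "inverse (norm x) ^ m > 0"
      using \<open>x \<noteq> 0\<close> by simp
    then show "sgn (h (sgn x)) = 1"
      unfolding h_sgn sgn_of_real by (simp only: sgn_pos of_real_1)
    have "root m (norm (h (sgn x))) = inverse (norm x)"
      unfolding h_sgn norm_of_real using m_pos by (simp add: real_root_power_cancel)
    then show "\<rho> (sgn x) = x"
      using \<open>x \<noteq> 0\<close> by (simp add: \<rho>_def sgn_div_norm)
  qed
  have \<rho>_in: "h (\<rho> y) = 1" "sgn (\<rho> y) = y" if "norm y = 1" "sgn (h y) = 1" for y
  proof -
    have "h y \<noteq> 0"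
      using that(2) by auto
    then have pos: "root m (norm (h y)) > 0"
      using m_pos by simp
    have "h y = of_real (norm (h y))"
      using that(2) \<open>h y \<noteq> 0\<close> by (simp add: sgn_div_norm scaleR_conv_of_real field_simps)
    then have "h y = of_real (root m (norm (h y)) ^ m)"
      using m_pos by simp
    then show "h (\<rho> y) = 1"
      using pos \<open>h y \<noteq> 0\<close>
      by (simp add: \<rho>_def scaleR_eq power_inverse)
    show "sgn (\<rho> y) = y"
      using pos that(1) by (simp add: \<rho>_def sgn_scaleR sgn_div_norm [of y])
  qed
  show "sgn ` milnor_fibre h = {x \<in> sphere 0 1. sgn (h x) = 1}"
  proof (intro equalityI subsetI)
    fix y assume y: "y \<in> {x \<in> sphere 0 1. sgn (h x) = 1}"
    then show "y \<in> sgn ` milnor_fibre h"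
      using \<rho>_in [of y] by (intro image_eqI [of _ _ "\<rho> y"]) (auto simp: milnor_fibre_def)
  qed (use sgn_in in \<open>auto simp: milnor_fibre_def\<close>)
  show "\<rho> ` {x \<in> sphere 0 1. sgn (h x) = 1} = milnor_fibre h"
  proof (intro equalityI subsetI)
    fix x assume x: "x \<in> milnor_fibre h"
    then show "x \<in> \<rho> ` {x \<in> sphere 0 1. sgn (h x) = 1}"
      using sgn_in [of x] by (intro image_eqI [of _ _ "sgn x"]) (auto simp: milnor_fibre_def)
  qed (use \<rho>_in in \<open>auto simp: milnor_fibre_def\<close>)
  show "continuous_on (milnor_fibre h) sgn"
    using h0 by (intro continuous_on_sgn continuous_on_id) (auto simp: milnor_fibre_def)
  show "continuous_on {x \<in> sphere 0 1. sgn (h x) = 1} \<rho>"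
    unfolding \<rho>_def using m_pos
    by (intro continuous_intros continuous_on_homogeneous_polynomial [OF homogeneous]) auto
  show "\<rho> (sgn x) = x" if "x \<in> milnor_fibre h" for x
    using that by (intro sgn_in) (simp add: milnor_fibre_def)
  show "sgn (\<rho> y) = y" if "y \<in> {x \<in> sphere 0 1. sgn (h x) = 1}" for y
    using that by (intro \<rho>_in) auto
qed

end

text \<open>The initial form is the first nonzero Taylor component, and the remainder after it has
  order \<open>Suc m\<close>. If all components were zero, \<open>f\<close> would vanish near
  0.\<close>

lemma leading_form_initial_form:
  fixes f :: "complex^'n \<Rightarrow> complex"
  assumes "holomorphic_germ f" "f 0 = 0" "\<not> germ_eq f (\<lambda>_. 0)"
  obtains m r C where "leading_form f (initial_form f) m r C"
proof -
  obtain r M where "holomorphic_cball f r M"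
    using holomorphic_germ_imp_holomorphic_cball [OF assms(1)] by blast
  then interpret holomorphic_cball f r M .
  define m where "m = germ_order f"
  have m: "m = (LEAST m. taylor m \<noteq> (\<lambda>_. 0))"
    unfolding m_def germ_order_def homogeneous_component_eq ..
  have form: "initial_form f = taylor m"
    unfolding initial_form_def homogeneous_component_eq m_def ..
  have "\<exists>m. taylor m \<noteq> (\<lambda>_. 0)"
  proof (rule ccontr)
    assume "\<not> ?thesis"
    then have "\<forall>j x. taylor j x = 0"
      by (auto simp: fun_eq_iff)
    then have "f x = 0" if "norm x < r" for x
      using taylor_sums [of 1 x] that sums_unique2 [OF _ sums_zero] by auto
    then have "germ_eq f (\<lambda>_. 0)"
      unfolding germ_eq_def eventually_nhds_metric using r_pos by (auto simp: dist_norm)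
    with assms(3) show False ..
  qed
  then have nz: "taylor m \<noteq> (\<lambda>_. 0)"
    unfolding m by (rule LeastI_ex)
  have zero: "taylor l = (\<lambda>_. 0)" if "l < m" for l
    using not_less_Least that unfolding m by blast
  \<comment> \<open>The component of degree 0 is the constant \<open>f 0\<close>.\<close>
  have "taylor 0 x = 0" for x
    using assms(2) by (simp add: taylor_def)
  then have "m > 0"
    using nz by (cases m) (auto simp: fun_eq_iff)
  \<comment> \<open>The Taylor remainder estimate holds on the ball of half the radius; its factor
    \<open>2 * M\<close> and the power of \<open>r\<close> form the constant.\<close>
  have "leading_form f (initial_form f) m (r / 2) (2 * M / r ^ Suc m)"
    unfolding form
  proof
    show "0 < m" "0 < r / 2" "0 \<le> 2 * M / r ^ Suc m" "homogeneous_polynomial m (taylor m)"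
      "\<exists>x. taylor m x \<noteq> 0"
      using \<open>m > 0\<close> r_pos M_nonneg homogeneous_polynomial_taylor nz by auto
    show "norm (f x - taylor m x) \<le> 2 * M / r ^ Suc m * norm x ^ Suc m" if "norm x \<le> r / 2" for x
      using taylor_remainder [OF that, of "Suc m"] by (simp add: zero power_divide)
    show "(\<lambda>z. f (a + z *s v)) holomorphic_on S" if "\<And>z. z \<in> S \<Longrightarrow> norm (a + z *s v) \<le> r / 2" for a v S
      using that r_pos by (intro holomorphic_line) force
  qed
  then show ?thesis
    using that by blast
qed

section \<open>Comparison along a blow-spherical homeomorphism\<close>

text \<open>Positive rescaling does not change \<open>sgn\<close>, so the limits of both sides give
  the two signs, whatever the degrees. The hypothesis \<open>k y \<noteq> 0\<close> excludes zeros
  of \<open>g\<close> near \<open>(y, 0)\<close>, hence of \<open>f\<close> near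
  \<open>(x, 0)\<close>, and Hurwitz' theorem gives \<open>h x \<noteq> 0\<close>. The one-sided
  form serves for a map and for its inverse.\<close>

lemma sgn_initial_forms_eq:
  assumes f: "leading_form f h m r C" and g: "leading_form g k n s D" and "norm x = 1"
    and \<Phi>: "filterlim \<Phi> (exceptional_filter y) (exceptional_filter x)"
    and eq: "\<forall>\<^sub>F p in exceptional_filter x. f (spherical_blowup p) = g (spherical_blowup (\<Phi> p))"
    and "k y \<noteq> 0"
  shows "sgn (h x) = sgn (k y)"
proof -
  interpret f: leading_form f h m r C by fact
  interpret g: leading_form g k n s D by fact
  have "\<forall>\<^sub>F q in exceptional_filter y. g (spherical_blowup q) / of_real (snd q) ^ n \<noteq> 0"
    by (rule tendsto_imp_eventually_ne [OF g.tendsto_rescaled \<open>k y \<noteq> 0\<close>])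
  then have "\<forall>\<^sub>F q in exceptional_filter y. g (spherical_blowup q) \<noteq> 0"
    by eventually_elim simp
  from eventually_compose_filterlim [OF this \<Phi>] eq
  have "\<forall>\<^sub>F p in exceptional_filter x. f (spherical_blowup p) \<noteq> 0"
    by eventually_elim simp
  with \<open>norm x = 1\<close> have "h x \<noteq> 0"
    by (rule f.initial_form_nonzero)
  have sgn_rescaled: "sgn (w / of_real t ^ j) = sgn w" if "t > 0" for w :: complex and t :: real and j
  proof -
    have "w / of_real t ^ j = inverse (t ^ j) *\<^sub>R w"
      by (simp add: scaleR_conv_of_real divide_inverse mult.commute)
    moreover have "inverse (t ^ j) > 0"
      using that by simp
    ultimately show ?thesis
      by (simp only: sgn_scaleR sgn_pos scaleR_one)
  qed
  have "((\<lambda>p. sgn (f (spherical_blowup p) / of_real (snd p) ^ m)) \<longlongrightarrow> sgn (h x)) (exceptional_filter x)"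
    using f.tendsto_rescaled \<open>h x \<noteq> 0\<close> by (rule tendsto_sgn)
  moreover have "((\<lambda>q. sgn (g (spherical_blowup q) / of_real (snd q) ^ n)) \<longlongrightarrow> sgn (k y)) (exceptional_filter y)"
    using g.tendsto_rescaled \<open>k y \<noteq> 0\<close> by (rule tendsto_sgn)
  from filterlim_compose [OF this \<Phi>]
  have "((\<lambda>p. sgn (f (spherical_blowup p) / of_real (snd p) ^ m)) \<longlongrightarrow> sgn (k y)) (exceptional_filter x)"
  proof (rule Lim_transform_eventually)
    show "\<forall>\<^sub>F p in exceptional_filter x. sgn (g (spherical_blowup (\<Phi> p)) / of_real (snd (\<Phi> p)) ^ n) =
        sgn (f (spherical_blowup p) / of_real (snd p) ^ m)"
      using eq eventually_exceptional_filter_in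
        eventually_compose_filterlim [OF eventually_exceptional_filter_in \<Phi>]
      by eventually_elim (metis sgn_rescaled)
  qed
  ultimately show "sgn (h x) = sgn (k y)"
    using tendsto_unique exceptional_filter_neq_bot [OF \<open>norm x = 1\<close>] by blast
qed

section \<open>Limits through the lifted homeomorphism and its inverse\<close>

lemma eventually_in_exceptional_nhd:
  assumes "exceptional_nhd A" "norm x = 1"
  shows "\<forall>\<^sub>F p in exceptional_filter x. p \<in> A"
proof -
  obtain T where T: "open T" "A = sphere 0 1 \<times> {0..} \<inter> T"
    using assms(1) unfolding exceptional_nhd_def openin_open by blast
  have "(x, 0) \<in> A"
    using assms unfolding exceptional_nhd_def by auto
  with T have "\<forall>\<^sub>F p in exceptional_filter x. p \<in> T"
    using topological_tendstoD [OF tendsto_exceptional_filter] by auto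
  with eventually_exceptional_filter_in show ?thesis
    by eventually_elim (auto simp: T(2) mem_Times_iff)
qed

text \<open>Continuity at \<open>(x, 0)\<close> gives the limit; \<open>pos\<close> keeps the images
  off the exceptional sphere, as the target filter requires.\<close>

lemma filterlim_exceptional_filter:
  assumes A: "exceptional_nhd A" and B: "exceptional_nhd B"
    and cont: "continuous_on A \<Phi>" and "\<Phi> ` A \<subseteq> B" and "norm x = 1" and val: "\<Phi> (x, 0) = (y, 0)"
    and pos: "\<And>p. p \<in> A \<Longrightarrow> snd p > 0 \<Longrightarrow> snd (\<Phi> p) > 0"
  shows "filterlim \<Phi> (exceptional_filter y) (exceptional_filter x)"
proof -
  have in_A: "\<forall>\<^sub>F p in exceptional_filter x. p \<in> A"
    by (rule eventually_in_exceptional_nhd) fact+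
  have "(x, 0) \<in> A"
    using A \<open>norm x = 1\<close> unfolding exceptional_nhd_def by auto
  with cont have "(\<Phi> \<longlongrightarrow> \<Phi> (x, 0)) (at (x, 0) within A)"
    by (simp add: continuous_on_def)
  moreover have "filterlim (\<lambda>p. p) (at (x, 0) within A) (exceptional_filter x)"
    unfolding filterlim_at using in_A eventually_exceptional_filter_in [of x] tendsto_exceptional_filter
    by (auto elim: eventually_elim2)
  ultimately have "(\<Phi> \<longlongrightarrow> (y, 0)) (exceptional_filter x)"
    using filterlim_compose [of \<Phi>] by (simp add: val)
  moreover have "\<forall>\<^sub>F p in exceptional_filter x. \<Phi> p \<in> sphere 0 1 \<times> {0<..} \<and> \<Phi> p \<noteq> (y, 0)"
    using in_A eventually_exceptional_filter_in
  proof eventually_elim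
    case (elim p)
    then have "\<Phi> p \<in> B" "snd (\<Phi> p) > 0"
      using assms(4) pos by auto
    moreover have "B \<subseteq> sphere 0 1 \<times> {0..}"
      using B openin_imp_subset unfolding exceptional_nhd_def by blast
    ultimately show ?case
      by (auto simp: mem_Times_iff)
  qed
  ultimately show ?thesis
    unfolding exceptional_filter_def [of y] filterlim_at by blast
qed

lemma milnor_fibre_homeomorphic_initial_forms:
  fixes f g :: "complex^'n \<Rightarrow> complex"
  assumes f: "leading_form f h m r C" and g: "leading_form g k n s D"
    and \<phi>: "blow_spherical_homeomorphism_germ \<phi>" and eq: "germ_eq f (g \<circ> \<phi>)"
  shows "milnor_fibre h homeomorphic milnor_fibre k"
proof -
  obtain U V \<psi> A B \<Phi> \<Psi> where \<phi>\<psi>: "homeomorphism U V \<phi> \<psi>" and "0 \<in> U" and \<phi>0: "\<phi> 0 = 0"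
    and \<Phi>\<Psi>: "homeomorphism A B \<Phi> \<Psi>" and A: "exceptional_nhd A" and B: "exceptional_nhd B"
    and \<Phi>_sphere: "\<Phi> ` (sphere 0 1 \<times> {0}) = sphere 0 1 \<times> {0}"
    and lift: "\<forall>(x, t)\<in>A. t > 0 \<longrightarrow> spherical_blowup (x, t) \<in> U \<and>
             \<Phi> (x, t) = spherical_blowup_inv (\<phi> (spherical_blowup (x, t)))"
    using \<phi> unfolding blow_spherical_homeomorphism_germ_def
    by (elim exE conjE) (rule that, assumption+)
  have sub_A: "sphere 0 1 \<times> {0} \<subseteq> A" "A \<subseteq> sphere 0 1 \<times> {0..}"
    and sub_B: "sphere 0 1 \<times> {0} \<subseteq> B"
    using A B openin_imp_subset unfolding exceptional_nhd_def by blast+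
  then have in_A: "(x, 0) \<in> A" and in_B: "(x, 0) \<in> B" if "norm x = 1" for x
    using that by auto
  have \<Phi>_cont: "continuous_on A \<Phi>" and \<Psi>_cont: "continuous_on B \<Psi>"
    and \<Phi>_im: "\<Phi> ` A = B" and \<Psi>_im: "\<Psi> ` B = A"
    and \<Psi>\<Phi>: "\<And>p. p \<in> A \<Longrightarrow> \<Psi> (\<Phi> p) = p" and \<Phi>\<Psi>_id: "\<And>q. q \<in> B \<Longrightarrow> \<Phi> (\<Psi> q) = q"
    using \<Phi>\<Psi> unfolding homeomorphism_def by auto
  \<comment> \<open>Injectivity of \<open>\<phi>\<close> and \<open>\<phi> 0 = 0\<close> keep images
    of nonzero points away from 0, where \<open>spherical_blowup_inv\<close> is a true
    inverse.\<close>
  have lift_pos: "snd (\<Phi> p) > 0" "spherical_blowup (\<Phi> p) = \<phi> (spherical_blowup p)"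
    if "p \<in> A" "snd p > 0" for p
  proof -
    have p: "spherical_blowup p \<in> U" "\<Phi> p = spherical_blowup_inv (\<phi> (spherical_blowup p))"
      using bspec [OF lift that(1)] that(2) by (simp_all add: case_prod_unfold)
    have "fst p \<in> sphere 0 1"
      using sub_A(2) that by (auto simp: mem_Times_iff)
    then have "spherical_blowup p \<noteq> 0"
      using that by (auto simp: spherical_blowup_def case_prod_unfold)
    then have "\<phi> (spherical_blowup p) \<noteq> 0"
      using \<phi>\<psi> p(1) \<open>0 \<in> U\<close> \<phi>0 unfolding homeomorphism_def by metis
    then show "snd (\<Phi> p) > 0" "spherical_blowup (\<Phi> p) = \<phi> (spherical_blowup p)"
      by (simp_all add: p(2) spherical_blowup_inv_def spherical_blowup_def)
  qed
  \<comment> \<open>\<open>\<nu>\<close> and \<open>\<mu>\<close> are the mutually inverse maps that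
    \<open>\<Phi>\<close> and \<open>\<Psi>\<close> induce on the exceptional sphere.\<close>
  define \<nu> where "\<nu> x = fst (\<Phi> (x, 0))" for x
  define \<mu> where "\<mu> y = fst (\<Psi> (y, 0))" for y
  have \<nu>: "\<Phi> (x, 0) = (\<nu> x, 0)" "norm (\<nu> x) = 1" if "norm x = 1" for x
  proof -
    have "\<Phi> (x, 0) \<in> \<Phi> ` (sphere 0 1 \<times> {0})"
      by (rule imageI) (simp add: that)
    then have "\<Phi> (x, 0) \<in> sphere 0 1 \<times> {0}"
      by (simp only: \<Phi>_sphere)
    then show "\<Phi> (x, 0) = (\<nu> x, 0)" "norm (\<nu> x) = 1"
      by (auto simp: \<nu>_def)
  qed
  have \<mu>: "\<Psi> (y, 0) = (\<mu> y, 0)" "norm (\<mu> y) = 1" if "norm y = 1" for y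
  proof -
    have "(y, 0) \<in> \<Phi> ` (sphere 0 1 \<times> {0})"
      using that unfolding \<Phi>_sphere by simp
    then obtain p where "p \<in> sphere 0 1 \<times> {0}" "(y, 0) = \<Phi> p"
      by blast
    then have "\<Psi> (y, 0) \<in> sphere 0 1 \<times> {0}"
      using \<Psi>\<Phi> [of p] sub_A(1) by auto
    then show "\<Psi> (y, 0) = (\<mu> y, 0)" "norm (\<mu> y) = 1"
      by (auto simp: \<mu>_def)
  qed
  have \<mu>\<nu>: "\<mu> (\<nu> x) = x" if "norm x = 1" for x
    using \<Psi>\<Phi> [OF in_A [OF that]] \<nu> [OF that] \<mu> [of "\<nu> x"] by simp
  have \<nu>\<mu>: "\<nu> (\<mu> y) = y" if "norm y = 1" for y
    using \<Phi>\<Psi>_id [OF in_B [OF that]] \<mu> [OF that] \<nu> [of "\<mu> y"] by simp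
  \<comment> \<open>If \<open>\<Psi> q\<close> lay on the exceptional sphere, then so would
    \<open>\<Phi> (\<Psi> q) = q\<close>.\<close>
  have \<Psi>_pos: "snd (\<Psi> q) > 0" if "q \<in> B" "snd q > 0" for q
  proof -
    have "\<Psi> q \<in> A"
      using that \<Psi>_im by blast
    then have *: "norm (fst (\<Psi> q)) = 1" "snd (\<Psi> q) \<ge> 0"
      using sub_A(2) by (auto simp: mem_Times_iff)
    have "snd (\<Psi> q) \<noteq> 0"
    proof
      assume "snd (\<Psi> q) = 0"
      then have "\<Psi> q = (fst (\<Psi> q), 0)"
        by (simp add: prod_eq_iff)
      then have "q = (\<nu> (fst (\<Psi> q)), 0)"
        using \<nu>(1) [OF *(1)] \<Phi>\<Psi>_id [OF that(1)] by simp
      then show False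
        using that(2) by (metis less_irrefl snd_conv)
    qed
    with * show ?thesis
      by simp
  qed
  have lim_\<Phi>: "filterlim \<Phi> (exceptional_filter (\<nu> x)) (exceptional_filter x)" if "norm x = 1" for x
    using A B \<Phi>_cont equalityD1 [OF \<Phi>_im] that \<nu>(1) [OF that] lift_pos(1)
    by (rule filterlim_exceptional_filter)
  have lim_\<Psi>: "filterlim \<Psi> (exceptional_filter x) (exceptional_filter (\<nu> x))" if "norm x = 1" for x
  proof (rule filterlim_exceptional_filter [OF B A \<Psi>_cont equalityD1 [OF \<Psi>_im] \<nu>(2) [OF that] _ \<Psi>_pos])
    show "\<Psi> (\<nu> x, 0) = (x, 0)"
      using \<mu>(1) [OF \<nu>(2) [OF that]] \<mu>\<nu> [OF that] by simp
  qed
  have ev_\<Phi>: "\<forall>\<^sub>F p in exceptional_filter x. f (spherical_blowup p) = g (spherical_blowup (\<Phi> p))"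
    if "norm x = 1" for x
  proof -
    have "\<forall>\<^sub>F p in exceptional_filter x. f (spherical_blowup p) = (g \<circ> \<phi>) (spherical_blowup p)"
      using eventually_compose_filterlim [OF _ tendsto_spherical_blowup_exceptional_filter] eq
      unfolding germ_eq_def .
    then show ?thesis
      using eventually_in_exceptional_nhd [OF A that] eventually_exceptional_filter_in
      by eventually_elim (simp add: lift_pos(2))
  qed
  have ev_\<Psi>: "\<forall>\<^sub>F q in exceptional_filter (\<nu> x). g (spherical_blowup q) = f (spherical_blowup (\<Psi> q))"
    if "norm x = 1" for x
    using eventually_compose_filterlim [OF ev_\<Phi> [OF that] lim_\<Psi> [OF that]]
      eventually_in_exceptional_nhd [OF B \<nu>(2) [OF that]]
    by eventually_elim (simp add: \<Phi>\<Psi>_id)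
  \<comment> \<open>The comparison needs a nonzero form at the target point, so one implication goes
    through \<open>\<Psi>\<close> and the other through \<open>\<Phi>\<close>.\<close>
  have sgn_iff: "sgn (h x) = 1 \<longleftrightarrow> sgn (k (\<nu> x)) = 1" if "norm x = 1" for x
  proof
    assume 1: "sgn (h x) = 1"
    then have "h x \<noteq> 0"
      by auto
    with 1 show "sgn (k (\<nu> x)) = 1"
      using sgn_initial_forms_eq [OF g f \<nu>(2) [OF that] lim_\<Psi> [OF that] ev_\<Psi> [OF that]] by simp
  next
    assume 1: "sgn (k (\<nu> x)) = 1"
    then have "k (\<nu> x) \<noteq> 0"
      by auto
    with 1 show "sgn (h x) = 1"
      using sgn_initial_forms_eq [OF f g that lim_\<Phi> [OF that] ev_\<Phi> [OF that]] by simp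
  qed
  have "{x \<in> sphere 0 1. sgn (h x) = 1} homeomorphic {y \<in> sphere 0 1. sgn (k y) = 1}"
  proof (rule homeomorphicI)
    show "\<nu> ` {x \<in> sphere 0 1. sgn (h x) = 1} = {y \<in> sphere 0 1. sgn (k y) = 1}"
    proof (intro equalityI subsetI)
      fix y assume "y \<in> {y \<in> sphere 0 1. sgn (k y) = 1}"
      then show "y \<in> \<nu> ` {x \<in> sphere 0 1. sgn (h x) = 1}"
        using \<mu>(2) [of y] \<nu>\<mu> [of y] sgn_iff [of "\<mu> y"] by (intro image_eqI [of _ _ "\<mu> y"]) auto
    qed (use \<nu> sgn_iff in auto)
    show "\<mu> ` {y \<in> sphere 0 1. sgn (k y) = 1} = {x \<in> sphere 0 1. sgn (h x) = 1}"
    proof (intro equalityI subsetI)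
      fix x assume "x \<in> {x \<in> sphere 0 1. sgn (h x) = 1}"
      then show "x \<in> \<mu> ` {y \<in> sphere 0 1. sgn (k y) = 1}"
        using \<nu>(2) [of x] \<mu>\<nu> [of x] sgn_iff [of x] by (intro image_eqI [of _ _ "\<nu> x"]) auto
    next
      fix x assume "x \<in> \<mu> ` {y \<in> sphere 0 1. sgn (k y) = 1}"
      then obtain y where "norm y = 1" "sgn (k y) = 1" "x = \<mu> y"
        by auto
      then show "x \<in> {x \<in> sphere 0 1. sgn (h x) = 1}"
        using \<mu>(2) [of y] \<nu>\<mu> [of y] sgn_iff [of x] by auto
    qed
    show "continuous_on {x \<in> sphere 0 1. sgn (h x) = 1} \<nu>"
      unfolding \<nu>_def using in_A
      by (intro continuous_on_fst continuous_on_compose2 [OF \<Phi>_cont] continuous_intros) auto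
    show "continuous_on {y \<in> sphere 0 1. sgn (k y) = 1} \<mu>"
      unfolding \<mu>_def using in_B
      by (intro continuous_on_fst continuous_on_compose2 [OF \<Psi>_cont] continuous_intros) auto
  qed (use \<mu>\<nu> \<nu>\<mu> in auto)
  from homeomorphic_trans [OF leading_form.milnor_fibre_homeomorphic [OF f] this]
    homeomorphic_sym [THEN iffD1, OF leading_form.milnor_fibre_homeomorphic [OF g]]
  show ?thesis
    by (rule homeomorphic_trans)
qed

theorem proposition2p8:
  fixes f g :: "complex^'n \<Rightarrow> complex" and \<phi> :: "complex^'n \<Rightarrow> complex^'n"
  assumes "holomorphic_germ f" and "f 0 = 0" and "reduced_germ f"
    and "holomorphic_germ g" and "g 0 = 0" and "reduced_germ g"
    and "blow_spherical_homeomorphism_germ \<phi>"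
    and "germ_eq f (g \<circ> \<phi>)"
  shows "milnor_fibre (initial_form f) homotopy_eqv milnor_fibre (initial_form g)"
proof -
  have "\<not> germ_eq f (\<lambda>_. 0)" "\<not> germ_eq g (\<lambda>_. 0)"
    using assms(3,6) by (auto simp: reduced_germ_def)
  then obtain m r C n s D where "leading_form f (initial_form f) m r C" "leading_form g (initial_form g) n s D"
    using leading_form_initial_form assms(1,2,4,5) by metis
  then show ?thesis
    using assms(7,8) by (intro homeomorphic_imp_homotopy_eqv milnor_fibre_homeomorphic_initial_forms)
qed

end
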